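(* Let $\theta\in\mathbb{C}$, $r\ge1$, $k\ge0$. The $\widetilde T$-fixed locus $\mathcal M_\theta(r,k)^{\widetilde T}$ is a finite set of points in bijective correspondence with length $r$ sequences $\vec\lambda=(\lambda^1,\dots,\lambda^r)$ of Young diagrams $\lambda^l$ of size $|\vec\lambda|=k$, where $|\vec\lambda|:=\sum_{l=1}^r|\lambda^l|$ and $|\lambda^l|$ is the number of points (boxes) of $\lambda^l$.
   Context: $q=\exp(\tfrac{\mathrm{i}}{2}\theta)$, $V=\mathbb{C}^k$, $W=\mathbb{C}^r$. The instanton moduli space $\mathcal M_\theta(r,k)$ of framed torsion free sheaves on the noncommutative projective plane $\mathbb{CP}^2_\theta$ is identified, $\widetilde T$-equivariantly, with the geometric invariant theory quotient by $GL(V)$, acting by $(gB_1g^{-1},gB_2g^{-1},gI,Jg^{-1})$, of the variety of $(B_1,B_2,I,J)\in\mathrm{End}(V)^2\oplus\mathrm{Hom}(W,V)\oplus\mathrm{Hom}(V,W)$ such that $B_1B_2-q^{-2}B_2B_1+IJ=0$ and no proper subspace $V'\subsetneq V$ is invariant under $B_1,B_2$ and contains $I(W)$. The torus is $\widetilde T=(\mathbb{C}^\times)^2\times(\mathbb{C}^\times)^{r-1}$, where $(\mathbb{C}^\times)^{r-1}$ is the maximal torus $\{\rho=\mathrm{diag}(\rho_1,\dots,\rho_r):\prod_l\rho_l=1\}$ of $SL(r)$ acting on $W=\mathbb{C}^r$. An element $(t_1,t_2,\rho)$ acts on the quotient by $$(B_1,B_2,I,J)\longmapsto(t_1B_1,\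 t_2B_2,\ t_1t_2\,I\rho^{-1},\ \rho J).$$ A Young diagram is a finite subset $\lambda\subset\mathbb{Z}_{\ge1}^2$ such that $(p_1,p_2)\in\lambda$ implies $(p_1',p_2')\in\lambda$ for all integers $1\le p_1'\le p_1$, $1\le p_2'\le p_2$. *)

theory Defs
  imports
    Complex_Main
    "HOL-Algebra.Group_Action"
    "Jordan_Normal_Form.VS_Connect"
begin

text \<open>
  With \<open>V\<close> and \<open>W\<close> the complex spaces of dimension \<open>k\<close> and \<open>r\<close>, linear maps are matrices:
  \<open>B1, B2\<close> are \<open>k \<times> k\<close>, \<open>I\<close> is \<open>k \<times> r\<close> and \<open>J\<close> is \<open>r \<times> k\<close>. Dimensions are
  carrier parameters and not types, so that \<open>k = 0\<close> is included.
\<close>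

type_synonym adhm = "complex mat \<times> complex mat \<times> complex mat \<times> complex mat"

definition q_param :: "complex \<Rightarrow> complex" where
  "q_param \<theta> = exp (\<i> / 2 * \<theta>)"

definition GL :: "nat \<Rightarrow> complex mat monoid" where
  "GL n = units_of (ring_mat TYPE(complex) n ())"

definition stable :: "nat \<Rightarrow> nat \<Rightarrow> adhm \<Rightarrow> bool" where
  "stable r k = (\<lambda>(B1, B2, I, J).
     \<not> (\<exists>U. subspace class_ring U (module_vec TYPE(complex) k) \<and> U \<subset> carrier_vec k \<and>
          (\<forall>v\<in>U. B1 *\<^sub>v v \<in> U) \<and> (\<forall>v\<in>U. B2 *\<^sub>v v \<in> U) \<and>
          (\<forall>w\<in>carrier_vec r. I *\<^sub>v w \<in> U)))"

definition stable_adhm :: "complex \<Rightarrow> nat \<Rightarrow> nat \<Rightarrow> adhm set" where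
  "stable_adhm \<theta> r k = {(B1, B2, I, J).
     B1 \<in> carrier_mat k k \<and> B2 \<in> carrier_mat k k \<and>
     I \<in> carrier_mat k r \<and> J \<in> carrier_mat r k \<and>
     B1 * B2 - (q_param \<theta> powi (-2)) \<cdot>\<^sub>m (B2 * B1) + I * J = 0\<^sub>m k k \<and>
     stable r k (B1, B2, I, J)}"

definition gl_act :: "nat \<Rightarrow> complex mat \<Rightarrow> adhm \<Rightarrow> adhm" where
  "gl_act k g = (\<lambda>(B1, B2, I, J).
     (g * B1 * inv\<^bsub>GL k\<^esub> g, g * B2 * inv\<^bsub>GL k\<^esub> g, g * I, J * inv\<^bsub>GL k\<^esub> g))"

text \<open>
  The points of the geometric invariant theory quotient. On the stable locus the action of
  \<open>GL k\<close> is free with closed orbits, so the quotient is geometric: its points are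
  the \<open>GL k\<close>-orbits of stable data.
\<close>

definition instanton_moduli :: "complex \<Rightarrow> nat \<Rightarrow> nat \<Rightarrow> adhm set set" where
  "instanton_moduli \<theta> r k = orbits (GL k) (stable_adhm \<theta> r k) (gl_act k)"

definition torus :: "nat \<Rightarrow> (complex \<times> complex \<times> complex mat) set" where
  "torus r = {(t1, t2, mat_diag r c) | t1 t2 c. t1 \<noteq> 0 \<and> t2 \<noteq> 0 \<and> (\<Prod>l<r. c l) = 1}"

definition torus_act :: "nat \<Rightarrow> complex \<times> complex \<times> complex mat \<Rightarrow> adhm \<Rightarrow> adhm" where
  "torus_act r = (\<lambda>(t1, t2, \<rho>) (B1, B2, I, J).
     (t1 \<cdot>\<^sub>m B1, t2 \<cdot>\<^sub>m B2, (t1 * t2) \<cdot>\<^sub>m (I * inv\<^bsub>GL r\<^esub> \<rho>), \<rho> * J))"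

text \<open>
  The torus action commutes with that of \<open>GL k\<close>, so it acts on the quotient by taking images
  of orbits.
\<close>

definition fixed_locus :: "complex \<Rightarrow> nat \<Rightarrow> nat \<Rightarrow> adhm set set" where
  "fixed_locus \<theta> r k = {p \<in> instanton_moduli \<theta> r k. \<forall>t\<in>torus r. torus_act r t ` p = p}"

definition young_diagram :: "(nat \<times> nat) set \<Rightarrow> bool" where
  "young_diagram L \<longleftrightarrow> finite L \<and> L \<subseteq> {1..} \<times> {1..} \<and>
     (\<forall>p1 p2 p1' p2'. (p1, p2) \<in> L \<and> 1 \<le> p1' \<and> p1' \<le> p1 \<and> 1 \<le> p2' \<and> p2' \<le> p2
        \<longrightarrow> (p1', p2') \<in> L)"

definition young_sequences :: "nat \<Rightarrow> nat \<Rightarrow> (nat \<times> nat) set list set" where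
  "young_sequences r k = {Ls. length Ls = r \<and> (\<forall>L\<in>set Ls. young_diagram L) \<and>
     (\<Sum>l<r. card (Ls ! l)) = k}"

end

theory Submission
  imports
    "Jordan_Normal_Form.Char_Poly"
    "HOL-Computational_Algebra.Primes"
    Defs
begin

text \<open>
  If the orbit of a stable \<open>(B1, B2, I, J)\<close> is fixed by a torus element \<open>t\<close>, some \<open>g\<close> in \<open>GL V\<close>
  realises the action of \<open>t\<close>, and each \<open>B1^a B2^b I e_l\<close> is zero or an eigenvector of \<open>g\<close> with
  eigenvalue \<open>t1^(a+1) t2^(b+1) / \<rho>_l\<close>. For one suitably generic \<open>t\<close> these eigenvalues are pairwise
  distinct and differ from all \<open>1 / \<rho>_m\<close>. The latter makes \<open>J\<close> vanish on these vectors, so that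
  \<open>B1\<close> and \<open>B2\<close> \<open>q\<close>-commute on them and their span is invariant, hence all of \<open>V\<close> by stability;
  the former bounds the number of nonzero ones by \<open>k\<close>. So the nonzero ones form a basis of \<open>V\<close>, the
  exponents \<open>(l, a, b)\<close> that occur form \<open>r\<close> Young diagrams with \<open>k\<close> boxes in total, and in this
  basis the datum is a normal form that depends only on the diagrams.
\<close>

section \<open>Matrices and subspaces\<close>

lemma mult_mat_unit_vec:
  assumes "(A :: 'a :: comm_semiring_1 mat) \<in> carrier_mat n m" "j < m"
  shows "A *\<^sub>v unit_vec m j = col A j"
  using assms by (intro eq_vecI) auto

lemma mat_eq_unit_vecI:
  assumes "(A :: 'a :: comm_semiring_1 mat) \<in> carrier_mat n m" "B \<in> carrier_mat n m"
    and "\<And>j. j < m \<Longrightarrow> A *\<^sub>v unit_vec m j = B *\<^sub>v unit_vec m j"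
  shows "A = B"
proof (rule mat_col_eqI)
  fix j assume "j < dim_col B"
  then have "j < m" using assms(2) by auto
  with assms(3)[OF this] show "col A j = col B j"
    using mult_mat_unit_vec[OF assms(1)] mult_mat_unit_vec[OF assms(2)] by simp
qed (use assms in auto)

lemma smult_mat_mult_vec:
  assumes "(A :: 'a :: comm_ring mat) \<in> carrier_mat n m" "v \<in> carrier_vec m"
  shows "(c \<cdot>\<^sub>m A) *\<^sub>v v = c \<cdot>\<^sub>v (A *\<^sub>v v)"
  using assms by (intro eq_vecI) auto

lemma mult_mat_zero_vec [simp]:
  assumes "(A :: 'a :: comm_ring mat) \<in> carrier_mat n m"
  shows "A *\<^sub>v 0\<^sub>v m = 0\<^sub>v n"
  using assms by (intro eq_vecI) auto

text \<open>If \<open>m < k\<close>, padding \<open>P\<close> and \<open>C\<close> with zeros to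
  \<open>k \<times> k\<close> keeps the product \<open>1\<close>, so the padded factors also
  multiply to \<open>1\<close> in the other order. But the padded \<open>P\<close> has a zero column
  at index \<open>m\<close>, so the diagonal entry there is \<open>0\<close>.\<close>

lemma right_inverse_dim_le:
  fixes P C :: "'a :: field mat"
  assumes P: "P \<in> carrier_mat k m" and C: "C \<in> carrier_mat m k" and PC: "P * C = 1\<^sub>m k"
  shows "k \<le> m"
proof (rule ccontr)
  assume "\<not> k \<le> m"
  then have mk: "m < k" by simp
  define P' where "P' = mat k k (\<lambda>(i, j). if j < m then P $$ (i, j) else 0)"
  define C' where "C' = mat k k (\<lambda>(i, j). if i < m then C $$ (i, j) else 0)"
  have P': "P' \<in> carrier_mat k k" and C': "C' \<in> carrier_mat k k"
    by (auto simp: P'_def C'_def)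
  have "P' * C' = P * C"
  proof (rule eq_matI)
    fix i j assume "i < dim_row (P * C)" "j < dim_col (P * C)"
    then have ij: "i < k" "j < k" using P C by auto
    have "(P' * C') $$ (i, j) = (\<Sum>s<k. P' $$ (i, s) * C' $$ (s, j))"
      using ij P' C' by (auto simp: scalar_prod_def atLeast0LessThan intro!: sum.cong)
    also have "\<dots> = (\<Sum>s<m. P $$ (i, s) * C $$ (s, j))"
      using ij mk by (intro sum.mono_neutral_cong_right) (auto simp: P'_def C'_def)
    also have "\<dots> = (P * C) $$ (i, j)"
      using ij P C by (auto simp: scalar_prod_def atLeast0LessThan intro!: sum.cong)
    finally show "(P' * C') $$ (i, j) = (P * C) $$ (i, j)" .
  qed (use P C P' C' in auto)
  then have "C' * P' = 1\<^sub>m k" using PC by (intro mat_mult_left_right_inverse[OF P' C']) simp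
  moreover have "(C' * P') $$ (m, m) = 0"
    using mk P' C' by (auto simp: scalar_prod_def P'_def)
  ultimately show False using mk by simp
qed

lemma subspace_vecI:
  assumes "U \<subseteq> carrier_vec n" "0\<^sub>v n \<in> U"
    and "\<And>v w. v \<in> U \<Longrightarrow> w \<in> U \<Longrightarrow> v + w \<in> U"
    and "\<And>c v. v \<in> U \<Longrightarrow> c \<cdot>\<^sub>v v \<in> U"
  shows "subspace class_ring U (module_vec TYPE('a :: field) n)"
  unfolding subspace_def
proof (intro conjI submodule.intro)
  show "vectorspace class_ring (module_vec TYPE('a) n)" by (rule vec_vs)
  show "module class_ring (module_vec TYPE('a) n)" by (rule vec_module)
qed (use assms in \<open>simp_all add: module_vec_simps\<close>)

text \<open>Used for stability: an invariant subspace that contains the standard basis cannot be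
  proper.\<close>

lemma subspace_eq_carrier_vec:
  assumes U: "subspace class_ring U (module_vec TYPE('a :: field) n)"
    and unit: "\<And>j. j < n \<Longrightarrow> unit_vec n j \<in> U"
  shows "carrier_vec n \<subseteq> U"
proof -
  interpret vec_space "TYPE('a)" n .
  have "submodule class_ring U V" using U by (simp add: subspace_def)
  moreover have "set (unit_vecs n) \<subseteq> U" using unit by (auto simp: unit_vecs_def)
  ultimately show ?thesis using span_is_subset[of "set (unit_vecs n)" U] span_unit_vecs_is_carrier by blast
qed

section \<open>Orbits of the general linear group\<close>

text \<open>For square matrices a one-sided inverse is two-sided. This ties the abstract group
  inverse in \<open>GL k\<close>, a group of units of the matrix ring, to a concrete matrix.\<close>

lemma GL_I:
  assumes "g \<in> carrier_mat k k" "h \<in> carrier_mat k k" "g * h = 1\<^sub>m k"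
  shows "g \<in> carrier (GL k)" "inv\<^bsub>GL k\<^esub> g = h"
proof -
  interpret R: ring "ring_mat TYPE(complex) k ()" by (rule ring_mat)
  interpret G: group "GL k" unfolding GL_def by (rule R.units_group)
  have hg: "h * g = 1\<^sub>m k" using assms by (rule mat_mult_left_right_inverse)
  have "g \<in> Units (ring_mat TYPE(complex) k ())" "h \<in> Units (ring_mat TYPE(complex) k ())"
    unfolding Units_def using assms hg by (auto simp: ring_mat_simps)
  then have *: "g \<in> carrier (GL k)" "h \<in> carrier (GL k)" by (auto simp: GL_def units_of_carrier)
  then show "g \<in> carrier (GL k)" by simp
  show "inv\<^bsub>GL k\<^esub> g = h"
    using * hg by (intro G.inv_equality) (auto simp: GL_def units_of_mult units_of_one ring_mat_simps)
qed

lemma GL_D: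
  assumes "g \<in> carrier (GL k)"
  shows "g \<in> carrier_mat k k" "inv\<^bsub>GL k\<^esub> g \<in> carrier_mat k k"
    "g * inv\<^bsub>GL k\<^esub> g = 1\<^sub>m k" "inv\<^bsub>GL k\<^esub> g * g = 1\<^sub>m k"
proof -
  have "g \<in> Units (ring_mat TYPE(complex) k ())" using assms by (simp add: GL_def units_of_carrier)
  then obtain h where h: "g \<in> carrier_mat k k" "h \<in> carrier_mat k k" "g * h = 1\<^sub>m k" "h * g = 1\<^sub>m k"
    by (auto simp: Units_def ring_mat_simps)
  then show "g \<in> carrier_mat k k" "inv\<^bsub>GL k\<^esub> g \<in> carrier_mat k k"
    "g * inv\<^bsub>GL k\<^esub> g = 1\<^sub>m k" "inv\<^bsub>GL k\<^esub> g * g = 1\<^sub>m k"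
    using GL_I[OF h(1-3)] by auto
qed

lemma group_GL: "group (GL k)"
proof -
  interpret R: ring "ring_mat TYPE(complex) k ()" by (rule ring_mat)
  show ?thesis unfolding GL_def by (rule R.units_group)
qed

lemma GL_mult: "g \<otimes>\<^bsub>GL k\<^esub> h = g * h"
  by (simp add: GL_def units_of_mult ring_mat_simps)

lemma GL_one: "\<one>\<^bsub>GL k\<^esub> = 1\<^sub>m k"
  by (simp add: GL_def units_of_one ring_mat_simps)

text \<open>Only the shapes are recorded, neither the equation nor stability, so that the laws of
  both group actions can be proved without checking that those conditions are preserved.\<close>

definition adhm_space :: "nat \<Rightarrow> nat \<Rightarrow> adhm set" where
  "adhm_space r k =
     carrier_mat k k \<times> carrier_mat k k \<times> carrier_mat k r \<times> carrier_mat r k"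

lemma stable_adhm_space: "stable_adhm \<theta> r k \<subseteq> adhm_space r k"
  by (auto simp: stable_adhm_def adhm_space_def)

text \<open>An inverse-free criterion: as \<open>g\<close> is invertible, each right factor
  \<open>inv g\<close> moves to the other side. All later comparisons of data go through these
  intertwining equations.\<close>

lemma gl_act_eq_iff:
  assumes g: "g \<in> carrier (GL k)"
    and x: "(B1, B2, I, J) \<in> adhm_space r k" and y: "(A1, A2, K, L) \<in> adhm_space r k"
  shows "gl_act k g (B1, B2, I, J) = (A1, A2, K, L) \<longleftrightarrow>
           g * B1 = A1 * g \<and> g * B2 = A2 * g \<and> g * I = K \<and> J = L * g"
proof -
  note G = GL_D[OF g]
  let ?h = "inv\<^bsub>GL k\<^esub> g"
  have *: "X * ?h = Y \<longleftrightarrow> X = Y * g"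
    if "X \<in> carrier_mat n k" "Y \<in> carrier_mat n k" for X Y n
  proof
    assume "X * ?h = Y"
    then have "Y * g = X * (?h * g)" using that G(1,2) by (auto simp: assoc_mult_mat[of _ n k _ k _ k])
    then show "X = Y * g" using that G by simp
  next
    assume "X = Y * g"
    then have "X * ?h = Y * (g * ?h)" using that G(1,2) by (auto simp: assoc_mult_mat[of _ n k _ k _ k])
    then show "X * ?h = Y" using that G by simp
  qed
  have "g * B1 * ?h = A1 \<longleftrightarrow> g * B1 = A1 * g" "g * B2 * ?h = A2 \<longleftrightarrow> g * B2 = A2 * g"
    "J * ?h = L \<longleftrightarrow> J = L * g"
    using *[of "g * B1" k A1] *[of "g * B2" k A2] *[of J r L] x y G(1) by (simp_all add: adhm_space_def)
  then show ?thesis unfolding gl_act_def by simp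
qed

lemma gl_act_space:
  assumes "g \<in> carrier (GL k)" "x \<in> adhm_space r k"
  shows "gl_act k g x \<in> adhm_space r k"
  using GL_D[OF assms(1)] assms(2) by (auto simp: adhm_space_def gl_act_def)

lemma gl_act_mult:
  assumes g: "g \<in> carrier (GL k)" and h: "h \<in> carrier (GL k)" and x: "x \<in> adhm_space r k"
  shows "gl_act k g (gl_act k h x) = gl_act k (g * h) x"
proof -
  interpret group "GL k" by (rule group_GL)
  note G = GL_D[OF g] note H = GL_D[OF h]
  have inv: "inv\<^bsub>GL k\<^esub> (g * h) = inv\<^bsub>GL k\<^esub> h * inv\<^bsub>GL k\<^esub> g"
    using inv_mult_group[OF g h] by (simp add: GL_mult)
  obtain B1 B2 I J where [simp]: "x = (B1, B2, I, J)" by (cases x)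
  let ?g = "inv\<^bsub>GL k\<^esub> g" and ?h = "inv\<^bsub>GL k\<^esub> h"
  have conj: "g * (h * B * ?h) * ?g = g * h * B * (?h * ?g)" if "B \<in> carrier_mat k k" for B
  proof -
    have "g * (h * B) = g * h * B"
      by (rule assoc_mult_mat[symmetric]) (use that G H in auto)
    moreover have "g * (h * B * ?h) = g * (h * B) * ?h"
      by (rule assoc_mult_mat[symmetric]) (use that G H in auto)
    moreover have "g * h * B * (?h * ?g) = g * h * B * ?h * ?g"
      by (rule assoc_mult_mat[symmetric]) (use that G H in auto)
    ultimately show ?thesis by simp
  qed
  have "g * (h * I) = g * h * I" "J * ?h * ?g = J * (?h * ?g)"
    using x G(1,2) H(1,2) by (auto simp: adhm_space_def)
  then show ?thesis using x conj[of B1] conj[of B2]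
    by (simp add: gl_act_def inv adhm_space_def)
qed

lemma gl_act_one: "x \<in> adhm_space r k \<Longrightarrow> gl_act k (1\<^sub>m k) x = x"
  using GL_I[of "1\<^sub>m k" k "1\<^sub>m k"] by (auto simp: adhm_space_def gl_act_def)

lemma GL_closed:
  assumes "g \<in> carrier (GL k)" "h \<in> carrier (GL k)"
  shows "g * h \<in> carrier (GL k)" "inv\<^bsub>GL k\<^esub> g \<in> carrier (GL k)"
proof -
  interpret group "GL k" by (rule group_GL)
  show "g * h \<in> carrier (GL k)" using m_closed[OF assms] by (simp add: GL_mult)
  show "inv\<^bsub>GL k\<^esub> g \<in> carrier (GL k)" using assms by simp
qed

lemma gl_act_inv:
  assumes "g \<in> carrier (GL k)" "x \<in> adhm_space r k"
  shows "gl_act k (inv\<^bsub>GL k\<^esub> g) (gl_act k g x) = x"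
  using assms gl_act_mult[OF GL_closed(2) assms] GL_D(4)[OF assms(1)] gl_act_one by simp

lemma orbit_self:
  assumes "x \<in> adhm_space r k"
  shows "x \<in> orbit (GL k) (gl_act k) x"
proof -
  interpret group "GL k" by (rule group_GL)
  show ?thesis unfolding orbit_def
    using gl_act_one[OF assms] one_closed[unfolded GL_one] by (metis (mono_tags, lifting) mem_Collect_eq)
qed

lemma orbit_gl_act:
  assumes g: "g \<in> carrier (GL k)" and x: "x \<in> adhm_space r k"
  shows "orbit (GL k) (gl_act k) (gl_act k g x) = orbit (GL k) (gl_act k) x"
proof -
  have "\<exists>h'. h' \<in> carrier (GL k) \<and> gl_act k h x = gl_act k h' (gl_act k g x)"
    if h: "h \<in> carrier (GL k)" for h
  proof (intro exI conjI)
    show "h * inv\<^bsub>GL k\<^esub> g \<in> carrier (GL k)" using g h by (intro GL_closed)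
    show "gl_act k h x = gl_act k (h * inv\<^bsub>GL k\<^esub> g) (gl_act k g x)"
      using gl_act_mult[OF h GL_closed(2)[OF g g] gl_act_space[OF g x]] gl_act_inv[OF g x] by simp
  qed
  moreover have "\<exists>h'. h' \<in> carrier (GL k) \<and> gl_act k h (gl_act k g x) = gl_act k h' x"
    if h: "h \<in> carrier (GL k)" for h
    using gl_act_mult[OF h g x] GL_closed(1)[OF h g] by blast
  ultimately show ?thesis unfolding orbit_def by (auto simp only: set_eq_iff mem_Collect_eq) metis+
qed

section \<open>Monomial vectors and their torus weights\<close>

text \<open>The vector \<open>B1^a B2^b I e_l\<close>. Since \<open>B1\<close> is applied last, it
  raises \<open>a\<close> with no relation needed, while \<open>B2\<close> raises \<open>b\<close>
  by definition only at \<open>a = 0\<close>. For \<open>a > 0\<close> the two maps must first be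
  commuted.\<close>

definition monomial_vec :: "adhm \<Rightarrow> nat \<times> nat \<times> nat \<Rightarrow> complex vec" where
  "monomial_vec = (\<lambda>(B1, B2, I, J) (l, a, b). ((*\<^sub>v) B1 ^^ a) (((*\<^sub>v) B2 ^^ b) (col I l)))"

definition support :: "nat \<Rightarrow> nat \<Rightarrow> adhm \<Rightarrow> (nat \<times> nat \<times> nat) set" where
  "support r k x = {(l, a, b). l < r \<and> monomial_vec x (l, a, b) \<noteq> 0\<^sub>v k}"

lemma monomial_vec_simps:
  "monomial_vec (B1, B2, I, J) (l, 0, 0) = col I l"
  "monomial_vec (B1, B2, I, J) (l, Suc a, b) = B1 *\<^sub>v monomial_vec (B1, B2, I, J) (l, a, b)"
  "monomial_vec (B1, B2, I, J) (l, 0, Suc b) = B2 *\<^sub>v monomial_vec (B1, B2, I, J) (l, 0, b)"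
  by (simp_all add: monomial_vec_def)

text \<open>Follows the order in which a monomial is built: \<open>right\<close> raises
  \<open>b\<close> along \<open>a = 0\<close>, then \<open>up\<close> raises
  \<open>a\<close>.\<close>

lemma monomial_induct [case_names zero right up]:
  assumes "\<And>l. P l 0 0" "\<And>l b. P l 0 b \<Longrightarrow> P l 0 (Suc b)"
    "\<And>l a b. P l a b \<Longrightarrow> P l (Suc a) b"
  shows "P l (a :: nat) (b :: nat)"
proof (induction a)
  case 0
  show ?case by (induction b) (use assms in auto)
qed (use assms in auto)

lemma monomial_vec_carrier:
  assumes "x \<in> adhm_space r k"
  shows "monomial_vec x (l, a, b) \<in> carrier_vec k"
proof -
  obtain B1 B2 I J where x: "x = (B1, B2, I, J)" by (cases x)
  show ?thesis using assms unfolding x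
    by (induction l a b rule: monomial_induct) (auto simp: monomial_vec_simps adhm_space_def)
qed

text \<open>The equations \<open>g * B1 = A1 * g\<close> and \<open>g * B2 = A2 * g\<close> let
  \<open>g\<close> be pulled out through every letter of the monomial.\<close>

lemma monomial_vec_gl_act:
  assumes g: "g \<in> carrier (GL k)" and x: "x \<in> adhm_space r k" and l: "l < r"
  shows "monomial_vec (gl_act k g x) (l, a, b) = g *\<^sub>v monomial_vec x (l, a, b)"
proof -
  obtain B1 B2 I J where X: "x = (B1, B2, I, J)" by (cases x)
  obtain A1 A2 K L where Y: "gl_act k g x = (A1, A2, K, L)" by (cases "gl_act k g x")
  note G = GL_D(1)[OF g]
  have sp: "(B1, B2, I, J) \<in> adhm_space r k" "(A1, A2, K, L) \<in> adhm_space r k"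
    using x X Y gl_act_space[OF g x] by auto
  have eq: "g * B1 = A1 * g" "g * B2 = A2 * g" "g * I = K"
    using gl_act_eq_iff[OF g sp] Y X by auto
  have comm: "A *\<^sub>v (g *\<^sub>v v) = g *\<^sub>v (B *\<^sub>v v)"
    if "g * B = A * g" "A \<in> carrier_mat k k" "B \<in> carrier_mat k k" "v \<in> carrier_vec k" for A B v
    using assoc_mult_mat_vec[OF that(2) G that(4)] assoc_mult_mat_vec[OF G that(3,4)] that(1) by simp
  have car: "A1 \<in> carrier_mat k k" "A2 \<in> carrier_mat k k" "B1 \<in> carrier_mat k k" "B2 \<in> carrier_mat k k"
    "I \<in> carrier_mat k r" using sp by (auto simp: adhm_space_def)
  have V: "monomial_vec (B1, B2, I, J) (l, a, b) \<in> carrier_vec k" for l a b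
    using monomial_vec_carrier sp(1) .
  show ?thesis using l unfolding Y unfolding X
  proof (induction l a b rule: monomial_induct)
    case (zero l)
    then show ?case using eq(3) G car by (auto simp: monomial_vec_simps)
  next
    case (right l b)
    then show ?case using comm[OF eq(2) car(2,4) V] by (simp add: monomial_vec_simps)
  next
    case (up l a b)
    then show ?case using comm[OF eq(1) car(1,3) V] by (simp add: monomial_vec_simps)
  qed
qed

lemma GL_mult_vec_eq_0_iff:
  assumes g: "g \<in> carrier (GL k)" and v: "v \<in> carrier_vec k"
  shows "g *\<^sub>v v = 0\<^sub>v k \<longleftrightarrow> v = 0\<^sub>v k"
proof
  note G = GL_D[OF g]
  assume "g *\<^sub>v v = 0\<^sub>v k"
  then have "inv\<^bsub>GL k\<^esub> g * g *\<^sub>v v = 0\<^sub>v k" using assoc_mult_mat_vec[OF G(2,1) v] G(2) by simp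
  then show "v = 0\<^sub>v k" using G v by simp
qed (use GL_D(1)[OF g] in simp)

text \<open>Invertible maps kill no nonzero vector. Hence the support is an invariant of the orbit,
  which later separates the fixed points.\<close>

lemma support_gl_act:
  assumes "g \<in> carrier (GL k)" and "x \<in> adhm_space r k"
  shows "support r k (gl_act k g x) = support r k x"
proof -
  have "monomial_vec (gl_act k g x) (l, a, b) = 0\<^sub>v k \<longleftrightarrow> monomial_vec x (l, a, b) = 0\<^sub>v k"
    if "l < r" for l a b
    unfolding monomial_vec_gl_act[OF assms that]
    by (rule GL_mult_vec_eq_0_iff[OF assms(1) monomial_vec_carrier[OF assms(2)]])
  then show ?thesis by (auto simp: support_def)
qed

text \<open>The exponents are shifted by one because the torus acts on \<open>I\<close> with the
  extra factor \<open>t1 * t2\<close>.\<close>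

definition weight :: "complex \<Rightarrow> complex \<Rightarrow> (nat \<Rightarrow> complex) \<Rightarrow> nat \<times> nat \<times> nat \<Rightarrow> complex" where
  "weight t1 t2 c = (\<lambda>(l, a, b). t1 ^ Suc a * t2 ^ Suc b / c l)"

lemma mat_diag_GL:
  assumes "\<And>i. i < n \<Longrightarrow> d i \<noteq> 0"
  shows "mat_diag n d \<in> carrier (GL n)" "inv\<^bsub>GL n\<^esub> (mat_diag n d) = mat_diag n (\<lambda>i. inverse (d i))"
proof -
  have "mat_diag n d * mat_diag n (\<lambda>i. inverse (d i)) = 1\<^sub>m n"
    unfolding mat_diag_diag using assms by (intro eq_matI) (auto simp: mat_diag_def)
  then show "mat_diag n d \<in> carrier (GL n)" "inv\<^bsub>GL n\<^esub> (mat_diag n d) = mat_diag n (\<lambda>i. inverse (d i))"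
    using GL_I[OF mat_diag_dim mat_diag_dim] by auto
qed

section \<open>The torus action on orbits and the weights of the monomial vectors\<close>

lemma torusE:
  assumes "t \<in> torus r"
  obtains t1 t2 c where "t = (t1, t2, mat_diag r c)" "t1 \<noteq> 0" "t2 \<noteq> 0" "\<And>l. l < r \<Longrightarrow> c l \<noteq> 0"
proof -
  obtain t1 t2 c where t: "t = (t1, t2, mat_diag r c)" "t1 \<noteq> 0" "t2 \<noteq> 0" "(\<Prod>l<r. c l) = 1"
    using assms by (auto simp: torus_def)
  have "c l \<noteq> 0" if "l < r" for l
    using t(4) that prod_zero_iff[of "{..<r}" c] by (metis finite_lessThan lessThan_iff one_neq_zero)
  with t that show ?thesis by blast
qed

lemma torus_act_space:
  assumes "t \<in> torus r" "x \<in> adhm_space r k"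
  shows "torus_act r t x \<in> adhm_space r k"
proof -
  obtain t1 t2 c where t: "t = (t1, t2, mat_diag r c)" "\<And>l. l < r \<Longrightarrow> c l \<noteq> 0"
    using torusE[OF assms(1)] by metis
  show ?thesis using assms(2) t
    by (auto simp: torus_act_def adhm_space_def mat_diag_GL intro: mult_carrier_mat[OF mat_diag_dim])
qed

lemma torus_act_gl_act:
  assumes t: "t \<in> torus r" and g: "g \<in> carrier (GL k)" and x: "x \<in> adhm_space r k"
  shows "torus_act r t (gl_act k g x) = gl_act k g (torus_act r t x)"
proof -
  obtain t1 t2 c where t': "t = (t1, t2, mat_diag r c)" "\<And>l. l < r \<Longrightarrow> c l \<noteq> 0"
    using torusE[OF t] by metis
  note G = GL_D(1,2)[OF g]
  obtain B1 B2 I J where X: "x = (B1, B2, I, J)" by (cases x)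
  have *: "mat_diag r d \<in> carrier_mat r r" for d :: "nat \<Rightarrow> complex" by simp
  have B: "B1 \<in> carrier_mat k k" "B2 \<in> carrier_mat k k" "I \<in> carrier_mat k r" "J \<in> carrier_mat r k"
    using x X by (auto simp: adhm_space_def)
  have "s \<cdot>\<^sub>m (g * A * inv\<^bsub>GL k\<^esub> g) = g * (s \<cdot>\<^sub>m A) * inv\<^bsub>GL k\<^esub> g" if "A \<in> carrier_mat k k" for A s
    using mult_smult_distrib[OF G(1) that] mult_smult_assoc_mat[OF mult_carrier_mat[OF G(1) that] G(2)] by simp
  moreover have "s \<cdot>\<^sub>m (g * I * mat_diag r d) = g * (s \<cdot>\<^sub>m (I * mat_diag r d))" for s d
    using mult_smult_distrib[OF G(1) mult_carrier_mat[OF B(3) *]] assoc_mult_mat[OF G(1) B(3) *] by simp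
  moreover have "mat_diag r d * (J * inv\<^bsub>GL k\<^esub> g) = mat_diag r d * J * inv\<^bsub>GL k\<^esub> g" for d
    using assoc_mult_mat[OF * B(4) G(2)] by simp
  ultimately show ?thesis using t' B mat_diag_GL[of r c]
    by (simp add: X torus_act_def gl_act_def)
qed

lemma orbit_image: "orbit G \<phi> x = (\<lambda>g. \<phi> g x) ` carrier G"
  by (auto simp: orbit_def)

text \<open>The two actions commute, so the image of the orbit of \<open>x\<close> is the orbit of
  the translate of \<open>x\<close>. Fixedness of a point of the quotient thus means that some
  \<open>g\<close> realises the action of \<open>t\<close> on a representative.\<close>

lemma torus_act_orbit_eq_iff:
  assumes t: "t \<in> torus r" and x: "x \<in> adhm_space r k"
  shows "torus_act r t ` orbit (GL k) (gl_act k) x = orbit (GL k) (gl_act k) x \<longleftrightarrow>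
           (\<exists>g\<in>carrier (GL k). gl_act k g x = torus_act r t x)"
proof
  assume "torus_act r t ` orbit (GL k) (gl_act k) x = orbit (GL k) (gl_act k) x"
  then have "torus_act r t x \<in> orbit (GL k) (gl_act k) x" using orbit_self[OF x] by blast
  then show "\<exists>g\<in>carrier (GL k). gl_act k g x = torus_act r t x" by (auto simp: orbit_def)
next
  assume "\<exists>g\<in>carrier (GL k). gl_act k g x = torus_act r t x"
  then obtain g where g: "g \<in> carrier (GL k)" "gl_act k g x = torus_act r t x" by blast
  have "torus_act r t ` orbit (GL k) (gl_act k) x = orbit (GL k) (gl_act k) (torus_act r t x)"
    unfolding orbit_image image_image by (intro image_cong) (simp_all add: torus_act_gl_act[OF t _ x])
  then show "torus_act r t ` orbit (GL k) (gl_act k) x = orbit (GL k) (gl_act k) x"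
    using orbit_gl_act[OF g(1) x] g(2) by simp
qed

lemma gl_act_eq_torus_act_iff:
  assumes g: "g \<in> carrier (GL k)" and x: "(B1, B2, I, J) \<in> adhm_space r k"
    and t: "(t1, t2, mat_diag r c) \<in> torus r" and c: "\<And>l. l < r \<Longrightarrow> c l \<noteq> 0"
  shows "gl_act k g (B1, B2, I, J) = torus_act r (t1, t2, mat_diag r c) (B1, B2, I, J) \<longleftrightarrow>
           g * B1 = (t1 \<cdot>\<^sub>m B1) * g \<and> g * B2 = (t2 \<cdot>\<^sub>m B2) * g \<and>
           g * I = (t1 * t2) \<cdot>\<^sub>m (I * mat_diag r (\<lambda>l. inverse (c l))) \<and> J = mat_diag r c * J * g"
  using gl_act_eq_iff[OF g x] torus_act_space[OF t x] mat_diag_GL(2)[OF c]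
  by (simp add: torus_act_def)

text \<open>Moving \<open>g\<close> inwards past \<open>B1\<close> or \<open>B2\<close> costs a
  factor \<open>t1\<close> or \<open>t2\<close>, and at the innermost column of \<open>I\<close> it
  leaves \<open>t1 * t2 / c l\<close>.\<close>

lemma monomial_vec_eigenvector:
  assumes g: "g \<in> carrier (GL k)" and x: "x \<in> adhm_space r k"
    and t: "(t1, t2, mat_diag r c) \<in> torus r" and c: "\<And>l. l < r \<Longrightarrow> c l \<noteq> 0"
    and gx: "gl_act k g x = torus_act r (t1, t2, mat_diag r c) x" and l: "l < r"
  shows "g *\<^sub>v monomial_vec x (l, a, b) = weight t1 t2 c (l, a, b) \<cdot>\<^sub>v monomial_vec x (l, a, b)"
proof -
  note G = GL_D(1)[OF g]
  obtain B1 B2 I J where X: "x = (B1, B2, I, J)" by (cases x)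
  have B: "B1 \<in> carrier_mat k k" "B2 \<in> carrier_mat k k" "I \<in> carrier_mat k r" "J \<in> carrier_mat r k"
    using x X by (auto simp: adhm_space_def)
  have eq: "g * B1 = (t1 \<cdot>\<^sub>m B1) * g" "g * B2 = (t2 \<cdot>\<^sub>m B2) * g"
    "g * I = (t1 * t2) \<cdot>\<^sub>m (I * mat_diag r (\<lambda>l. inverse (c l)))"
    using gl_act_eq_torus_act_iff[OF g x[unfolded X] t c] gx X by auto
  have V: "monomial_vec (B1, B2, I, J) (l, a, b) \<in> carrier_vec k" for l a b
    using monomial_vec_carrier x X by simp
  have step: "g *\<^sub>v (A *\<^sub>v v) = (s * w) \<cdot>\<^sub>v (A *\<^sub>v v)"
    if "g * A = (s \<cdot>\<^sub>m A) * g" "A \<in> carrier_mat k k" "v \<in> carrier_vec k" "g *\<^sub>v v = w \<cdot>\<^sub>v v" for A s v w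
  proof -
    have "g *\<^sub>v (A *\<^sub>v v) = ((s \<cdot>\<^sub>m A) * g) *\<^sub>v v" using that G by (simp flip: that(1))
    also have "\<dots> = (s \<cdot>\<^sub>m A) *\<^sub>v (g *\<^sub>v v)" using that(2,3) G by (intro assoc_mult_mat_vec) auto
    also have "\<dots> = s \<cdot>\<^sub>v (A *\<^sub>v (w \<cdot>\<^sub>v v))" using that by (simp add: smult_mat_mult_vec[of _ k k])
    finally show ?thesis using that(2,3) by (simp add: mult_mat_vec[of _ k k] smult_smult_assoc)
  qed
  show ?thesis using l unfolding X
  proof (induction l a b rule: monomial_induct)
    case (zero l)
    have "g *\<^sub>v col I l = col (g * I) l" using zero G B by simp
    also have "\<dots> = (t1 * t2 / c l) \<cdot>\<^sub>v col I l"
      unfolding eq(3) using zero B by (intro eq_vecI) (auto simp: mat_diag_mult_right[of _ k] divide_inverse)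
    finally show ?case by (simp add: monomial_vec_simps weight_def)
  next
    case (right l b)
    then show ?case using step[OF eq(2) B(2) V, of l 0 b] by (simp add: monomial_vec_simps weight_def mult_ac)
  next
    case (up l a b)
    then show ?case using step[OF eq(1) B(1) V, of l a b] by (simp add: monomial_vec_simps weight_def mult_ac)
  qed
qed

section \<open>Normal forms attached to boxes\<close>

text \<open>For an injective enumeration \<open>e\<close> this is the basis vector of the box
  \<open>s\<close>, and it is zero for a box that \<open>e\<close> does not list. The formulas for
  the normal form then need no case split at the boundary of a diagram.\<close>

definition box_vec :: "(nat \<Rightarrow> 'b) \<Rightarrow> nat \<Rightarrow> 'b \<Rightarrow> complex vec" where
  "box_vec e m s = vec m (\<lambda>i. if e i = s then 1 else 0)"

lemma box_vec_unit_vec: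
  assumes "inj_on e {..<m}" "j < m"
  shows "box_vec e m (e j) = unit_vec m j"
  using assms by (intro eq_vecI) (auto simp: box_vec_def inj_on_def)

lemma box_vec_eq_0:
  assumes "s \<notin> e ` {..<m}"
  shows "box_vec e m s = 0\<^sub>v m"
  using assms by (intro eq_vecI) (auto simp: box_vec_def)

lemma box_vec_carrier [simp]: "box_vec e m s \<in> carrier_vec m"
  by (simp add: box_vec_def)

text \<open>
  The basis vector \<open>i\<close> plays the role of \<open>B1^a B2^b I e_l\<close> for \<open>e i = (l, a, b)\<close>, and \<open>Q\<close> that of
  \<open>q\<^sup>2\<close>; the entries of the second matrix come from \<open>B2 B1^a = Q^a B1^a B2\<close>.
\<close>

definition model :: "complex \<Rightarrow> nat \<Rightarrow> nat \<Rightarrow> (nat \<Rightarrow> nat \<times> nat \<times> nat) \<Rightarrow> adhm" where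
  "model Q r m e =
     (mat m m (\<lambda>(i, j). case e j of (l, a, b) \<Rightarrow> if e i = (l, Suc a, b) then 1 else 0),
      mat m m (\<lambda>(i, j). case e j of (l, a, b) \<Rightarrow> if e i = (l, a, Suc b) then Q ^ a else 0),
      mat m r (\<lambda>(i, l). if e i = (l, 0, 0) then 1 else 0),
      0\<^sub>m r m)"

lemma model_space: "model Q r m e \<in> adhm_space r m"
  by (auto simp: model_def adhm_space_def)

lemma model_mult_box_vec:
  assumes M: "model Q r m e = (M1, M2, K, L)" and inj: "inj_on e {..<m}"
  shows "(l, a, b) \<in> e ` {..<m} \<Longrightarrow> M1 *\<^sub>v box_vec e m (l, a, b) = box_vec e m (l, Suc a, b)"
    and "(l, a, b) \<in> e ` {..<m} \<Longrightarrow> M2 *\<^sub>v box_vec e m (l, a, b) = Q ^ a \<cdot>\<^sub>v box_vec e m (l, a, Suc b)"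
    and "l < r \<Longrightarrow> col K l = box_vec e m (l, 0, 0)"
    and "L = 0\<^sub>m r m"
proof -
  have car: "M1 \<in> carrier_mat m m" "M2 \<in> carrier_mat m m" using M by (auto simp: model_def)
  {
    assume "(l, a, b) \<in> e ` {..<m}"
    then obtain j where j: "j < m" "e j = (l, a, b)" by auto
    have *: "box_vec e m (l, a, b) = unit_vec m j" using box_vec_unit_vec[OF inj j(1)] j(2) by simp
    show "M1 *\<^sub>v box_vec e m (l, a, b) = box_vec e m (l, Suc a, b)"
      unfolding * mult_mat_unit_vec[OF car(1) j(1)]
      using M j by (intro eq_vecI) (auto simp: model_def box_vec_def)
    show "M2 *\<^sub>v box_vec e m (l, a, b) = Q ^ a \<cdot>\<^sub>v box_vec e m (l, a, Suc b)"
      unfolding * mult_mat_unit_vec[OF car(2) j(1)]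
      using M j by (intro eq_vecI) (auto simp: model_def box_vec_def)
  }
  show "l < r \<Longrightarrow> col K l = box_vec e m (l, 0, 0)"
    using M by (intro eq_vecI) (auto simp: model_def box_vec_def)
  show "L = 0\<^sub>m r m" using M by (simp add: model_def)
qed

text \<open>Boxes are counted from \<open>0\<close> here, but from \<open>1\<close> in \<^const>\<open>young_diagram\<close>.\<close>

definition box_ideal :: "nat \<Rightarrow> (nat \<times> nat \<times> nat) set \<Rightarrow> bool" where
  "box_ideal r S \<longleftrightarrow> finite S \<and> S \<subseteq> {..<r} \<times> UNIV \<and>
     (\<forall>l a b. (l, Suc a, b) \<in> S \<longrightarrow> (l, a, b) \<in> S) \<and>
     (\<forall>l a b. (l, a, Suc b) \<in> S \<longrightarrow> (l, a, b) \<in> S)"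

lemma box_ideal_finite: "box_ideal r S \<Longrightarrow> finite S"
  by (simp add: box_ideal_def)

lemma box_ideal_less: "box_ideal r S \<Longrightarrow> (l, a, b) \<in> S \<Longrightarrow> l < r"
  unfolding box_ideal_def by blast

text \<open>Inside the set of boxes the matrices move one box on. Outside it the vector is already
  zero, and the next box is missing too because the set is an ideal. The powers of \<open>Q\<close>
  do not show up, as \<open>B2\<close> is applied only at \<open>a = 0\<close>.\<close>

lemma model_monomial_vec:
  assumes inj: "inj_on e {..<m}" and S: "box_ideal r (e ` {..<m})" and l: "l < r"
  shows "monomial_vec (model Q r m e) (l, a, b) = box_vec e m (l, a, b)"
proof -
  obtain M1 M2 K L where M: "model Q r m e = (M1, M2, K, L)" by (cases "model Q r m e")
  have car: "M1 \<in> carrier_mat m m" "M2 \<in> carrier_mat m m" using M by (auto simp: model_def)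
  note mm = model_mult_box_vec[OF M inj]
  show ?thesis using l unfolding M
  proof (induction l a b rule: monomial_induct)
    case (zero l)
    then show ?case using mm(3) by (simp add: monomial_vec_simps)
  next
    case (right l b)
    show ?case
    proof (cases "(l, 0, b) \<in> e ` {..<m}")
      case True
      then show ?thesis using right mm(2)[OF True] by (simp add: monomial_vec_simps)
    next
      case False
      moreover from this have "(l, 0, Suc b) \<notin> e ` {..<m}" using S unfolding box_ideal_def by blast
      ultimately show ?thesis using right car by (simp add: monomial_vec_simps box_vec_eq_0)
    qed
  next
    case (up l a b)
    show ?case
    proof (cases "(l, a, b) \<in> e ` {..<m}")
      case True
      then show ?thesis using up mm(1)[OF True] by (simp add: monomial_vec_simps)
    next
      case False
      moreover from this have "(l, Suc a, b) \<notin> e ` {..<m}" using S unfolding box_ideal_def by blast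
      ultimately show ?thesis using up car by (simp add: monomial_vec_simps box_vec_eq_0)
    qed
  qed
qed

lemma support_model:
  assumes inj: "inj_on e {..<m}" and S: "box_ideal r (e ` {..<m})"
  shows "support r m (model Q r m e) = e ` {..<m}"
proof -
  have "box_vec e m s = 0\<^sub>v m \<longleftrightarrow> s \<notin> e ` {..<m}" for s
    using box_vec_eq_0[of s e m] box_vec_unit_vec[OF inj] by auto
  moreover have "l < r" if "(l, a, b) \<in> e ` {..<m}" for l a b using box_ideal_less[OF S that] .
  ultimately have "(l, a, b) \<in> support r m (model Q r m e) \<longleftrightarrow> (l, a, b) \<in> e ` {..<m}" for l a b
    using model_monomial_vec[OF assms, of l Q a b] unfolding support_def mem_Collect_eq prod.case
    by (metis (no_types, lifting))
  then show ?thesis by (simp only: set_eq_iff split_paired_All simp_thms)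
qed

section \<open>The normal forms are stable and torus-fixed\<close>

lemma monomial_vec_in_invariant:
  assumes x: "(B1, B2, I, J) \<in> adhm_space r k" and l: "l < r"
    and inv: "\<forall>v\<in>U. B1 *\<^sub>v v \<in> U" "\<forall>v\<in>U. B2 *\<^sub>v v \<in> U" "\<forall>w\<in>carrier_vec r. I *\<^sub>v w \<in> U"
  shows "monomial_vec (B1, B2, I, J) (l, a, b) \<in> U"
  using l
proof (induction l a b rule: monomial_induct)
  case (zero l)
  moreover have "I \<in> carrier_mat k r" using x by (simp add: adhm_space_def)
  ultimately show ?case using inv(3) mult_mat_unit_vec[of I k r l] by (metis monomial_vec_simps(1) unit_vec_carrier)
qed (use inv in \<open>auto simp: monomial_vec_simps\<close>)

text \<open>On the basis vector of \<open>(l, a, b)\<close> both products give a multiple of the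
  vector of \<open>(l, Suc a, Suc b)\<close>, with coefficients \<open>Q ^ a\<close> and
  \<open>Q ^ Suc a\<close>; the fourth matrix is zero. For stability, each basis vector is a
  monomial vector and so lies in every invariant subspace that contains the image of
  \<open>I\<close>.\<close>

lemma model_stable_adhm:
  assumes inj: "inj_on e {..<m}" and S: "box_ideal r (e ` {..<m})" and Q: "Q = q_param \<theta> ^ 2"
  shows "model Q r m e \<in> stable_adhm \<theta> r m"
proof -
  obtain M1 M2 K L where M: "model Q r m e = (M1, M2, K, L)" by (cases "model Q r m e")
  have car: "M1 \<in> carrier_mat m m" "M2 \<in> carrier_mat m m" "K \<in> carrier_mat m r"
    using M by (auto simp: model_def)
  note mm = model_mult_box_vec[OF M inj]
  have sp: "(M1, M2, K, L) \<in> adhm_space r m" using model_space M by metis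
  have Q0: "Q \<noteq> 0" by (simp add: Q q_param_def)
  have "M1 * M2 = inverse Q \<cdot>\<^sub>m (M2 * M1)"
  proof (rule mat_eq_unit_vecI)
    fix j assume j: "j < m"
    obtain l a b where ej: "e j = (l, a, b)" by (cases "e j")
    have v: "unit_vec m j = box_vec e m (l, a, b)" using box_vec_unit_vec[OF inj j] ej by simp
    have in_S: "(l, a, b) \<in> e ` {..<m}" using j ej by force
    \<comment> \<open>If one of the two paths to the diagonal neighbour leaves the diagram, the
      neighbour is not in it either, so both products vanish.\<close>
    have z: "(l, Suc a, Suc b) \<notin> e ` {..<m}" if "(l, Suc a, b) \<notin> e ` {..<m} \<or> (l, a, Suc b) \<notin> e ` {..<m}"
      using that S unfolding box_ideal_def by blast
    have "M1 *\<^sub>v box_vec e m (l, a, Suc b) = box_vec e m (l, Suc a, Suc b)"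
      using mm(1)[of l a "Suc b"] z box_vec_eq_0[of _ e m] car by (metis mult_mat_zero_vec)
    then have 1: "(M1 * M2) *\<^sub>v unit_vec m j = Q ^ a \<cdot>\<^sub>v box_vec e m (l, Suc a, Suc b)"
      unfolding v using assoc_mult_mat_vec[OF car(1,2), of "box_vec e m (l, a, b)"] car
      by (simp add: mm(2)[OF in_S] mult_mat_vec[OF car(1)])
    have "M2 *\<^sub>v box_vec e m (l, Suc a, b) = Q ^ Suc a \<cdot>\<^sub>v box_vec e m (l, Suc a, Suc b)"
    proof (cases "(l, Suc a, b) \<in> e ` {..<m}")
      case False
      then have "box_vec e m (l, Suc a, Suc b) = 0\<^sub>v m" using z by (intro box_vec_eq_0) simp
      moreover have "box_vec e m (l, Suc a, b) = 0\<^sub>v m" using False by (rule box_vec_eq_0)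
      ultimately show ?thesis using car(2) by (auto intro: eq_vecI)
    qed (rule mm(2))
    then have 2: "(M2 * M1) *\<^sub>v unit_vec m j = Q ^ Suc a \<cdot>\<^sub>v box_vec e m (l, Suc a, Suc b)"
      unfolding v using assoc_mult_mat_vec[OF car(2,1), of "box_vec e m (l, a, b)"]
      by (simp add: mm(1)[OF in_S])
    have 3: "inverse Q * Q ^ Suc a = Q ^ a" using Q0 by simp
    show "(M1 * M2) *\<^sub>v unit_vec m j = (inverse Q \<cdot>\<^sub>m (M2 * M1)) *\<^sub>v unit_vec m j"
      unfolding 1 smult_mat_mult_vec[OF mult_carrier_mat[OF car(2,1)] unit_vec_carrier] 2 smult_smult_assoc 3 ..
  qed (use car in auto)
  moreover have "q_param \<theta> powi (-2) = inverse Q" by (simp add: Q power_int_minus)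
  ultimately have rel: "M1 * M2 - (q_param \<theta> powi (-2)) \<cdot>\<^sub>m (M2 * M1) + K * L = 0\<^sub>m m m"
    using car mm(4) by (intro eq_matI) auto
  have "U = carrier_vec m"
    if U: "subspace class_ring U (module_vec TYPE(complex) m)" "U \<subseteq> carrier_vec m"
      and inv: "\<forall>v\<in>U. M1 *\<^sub>v v \<in> U" "\<forall>v\<in>U. M2 *\<^sub>v v \<in> U" "\<forall>w\<in>carrier_vec r. K *\<^sub>v w \<in> U" for U
  proof (rule antisym[OF U(2) subspace_eq_carrier_vec[OF U(1)]])
    fix j assume j: "j < m"
    obtain l a b where ej: "e j = (l, a, b)" by (cases "e j")
    have "(l, a, b) \<in> e ` {..<m}" using j ej by force
    then have "l < r" by (rule box_ideal_less[OF S])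
    then show "unit_vec m j \<in> U"
      using monomial_vec_in_invariant[OF sp _ inv, of l a b] model_monomial_vec[OF inj S, of l Q a b]
        box_vec_unit_vec[OF inj j] ej M by simp
  qed
  then have "stable r m (M1, M2, K, L)" unfolding stable_def by blast
  then show ?thesis using rel sp by (auto simp: M stable_adhm_def adhm_space_def)
qed

lemma model_fixed:
  assumes inj: "inj_on e {..<m}" and S: "box_ideal r (e ` {..<m})" and t: "t \<in> torus r"
  shows "\<exists>g\<in>carrier (GL m). gl_act m g (model Q r m e) = torus_act r t (model Q r m e)"
proof -
  obtain t1 t2 c where t': "t = (t1, t2, mat_diag r c)" "t1 \<noteq> 0" "t2 \<noteq> 0" and c: "\<And>l. l < r \<Longrightarrow> c l \<noteq> 0"
    using torusE[OF t] by metis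
  obtain M1 M2 K L where M: "model Q r m e = (M1, M2, K, L)" by (cases "model Q r m e")
  have car: "M1 \<in> carrier_mat m m" "M2 \<in> carrier_mat m m" "K \<in> carrier_mat m r"
    using M by (auto simp: model_def)
  \<comment> \<open>The compensating element is diagonal, with the weight of each box as its entry:
    one step in \<open>a\<close> or \<open>b\<close> multiplies the weight by \<open>t1\<close> or
    \<open>t2\<close>.\<close>
  define d where "d i = weight t1 t2 c (e i)" for i
  have "d i \<noteq> 0" if "i < m" for i
  proof -
    obtain l a b where s: "e i = (l, a, b)" by (cases "e i")
    then have "(l, a, b) \<in> e ` {..<m}" using that by force
    then have "c l \<noteq> 0" using c box_ideal_less[OF S] by blast
    then show ?thesis using t' by (simp add: d_def weight_def s)
  qed
  then have g: "mat_diag m d \<in> carrier (GL m)" by (rule mat_diag_GL)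
  have "mat_diag m d * M1 = (t1 \<cdot>\<^sub>m M1) * mat_diag m d"
    using M car
    by (simp add: mat_diag_mult_left[of _ m m] mat_diag_mult_right[of _ m m])
       (auto intro!: eq_matI simp: model_def d_def weight_def split: prod.split)
  moreover have "mat_diag m d * M2 = (t2 \<cdot>\<^sub>m M2) * mat_diag m d"
    using M car
    by (simp add: mat_diag_mult_left[of _ m m] mat_diag_mult_right[of _ m m])
       (auto intro!: eq_matI simp: model_def d_def weight_def split: prod.split)
  moreover have "mat_diag m d * K = (t1 * t2) \<cdot>\<^sub>m (K * mat_diag r (\<lambda>l. inverse (c l)))"
    using M car
    by (simp add: mat_diag_mult_left[of _ m r] mat_diag_mult_right[of _ m r])
       (auto intro!: eq_matI simp: model_def d_def weight_def divide_inverse split: prod.split)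
  moreover have "L = mat_diag r c * L * mat_diag m d"
    unfolding model_mult_box_vec(4)[OF M inj]
    by (simp add: right_mult_zero_mat[OF mat_diag_dim] left_mult_zero_mat[OF mat_diag_dim])
  ultimately have "gl_act m (mat_diag m d) (M1, M2, K, L) = torus_act r (t1, t2, mat_diag r c) (M1, M2, K, L)"
    using gl_act_eq_torus_act_iff[OF g _ _ c] model_space[of Q r m e] t t'(1) M by simp
  then show ?thesis using g t' M by auto
qed

section \<open>A generic torus element\<close>

text \<open>The exponents are recovered as the multiplicities of the primes 2, 3 and 5.\<close>

lemma two_three_five_powers_inj:
  fixes a b c a' b' c' :: nat
  assumes "2 ^ a * 3 ^ b * 5 ^ c = (2 ^ a' * 3 ^ b' * 5 ^ c' :: nat)"
  shows "a = a'" "b = b'" "c = c'"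
proof -
  have m: "multiplicity p (2 ^ a * 3 ^ b * 5 ^ c :: nat) =
      a * multiplicity p 2 + b * multiplicity p 3 + c * multiplicity p 5" if "prime p" for p a b c :: nat
    using that by (simp add: prime_elem_multiplicity_mult_distrib prime_elem_multiplicity_power_distrib)
  have p: "prime (2 :: nat)" "prime (3 :: nat)" "prime (5 :: nat)" by simp_all
  have z: "multiplicity p q = 0" if "prime p" "prime q" "p \<noteq> q" for p q :: nat
    using that by (simp add: prime_multiplicity_other)
  have o: "multiplicity p p = 1" if "prime p" for p :: nat
    using that by (simp add: multiplicity_prime)
  show "a = a'" using m[OF p(1), of a b c] m[OF p(1), of a' b' c'] assms o[OF p(1)] z p by simp
  show "b = b'" using m[OF p(2), of a b c] m[OF p(2), of a' b' c'] assms o[OF p(2)] z p by simp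
  show "c = c'" using m[OF p(3), of a b c] m[OF p(3), of a' b' c'] assms o[OF p(3)] z p by simp
qed

text \<open>
  With \<open>t1 = 2\<close> and \<open>t2 = 3\<close>, unique factorization separates the weights. The base is \<open>25\<close> and not
  \<open>5\<close> so that the normalization to determinant \<open>1\<close> needs no square root of \<open>5\<close>.
\<close>

definition generic_coeff :: "nat \<Rightarrow> nat \<Rightarrow> complex" where
  "generic_coeff r l = 25 ^ l / 5 ^ (r - 1)"

lemma generic_coeff_nonzero: "generic_coeff r l \<noteq> 0"
  by (simp add: generic_coeff_def)

lemma generic_torus: "(2, 3, mat_diag r (generic_coeff r)) \<in> torus r"
proof -
  \<comment> \<open>The numerators multiply to \<open>5 ^ (r * (r - 1))\<close>, which is what the
    \<open>r\<close> denominators \<open>5 ^ (r - 1)\<close> cancel.\<close>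
  have "(\<Prod>l<n. 25 ^ l) = (5 ^ (n * (n - 1)) :: complex)" for n
  proof (induction n)
    case (Suc n)
    have "(25 :: complex) ^ n = 5 ^ (2 * n)" by (simp add: power_mult)
    moreover have "n * (n - 1) + 2 * n = Suc n * n" by (cases n) (auto simp: algebra_simps)
    moreover have "(\<Prod>l<Suc n. 25 ^ l) = (5 ^ (n * (n - 1)) * 25 ^ n :: complex)" using Suc by simp
    ultimately show ?case by (metis diff_Suc_1 power_add)
  qed simp
  then have "(\<Prod>l<r. generic_coeff r l) = 1"
    by (simp add: generic_coeff_def prod_dividef mult.commute flip: power_mult)
  then show ?thesis unfolding torus_def by fastforce
qed

text \<open>The product cancels the normalization \<open>5 ^ (r - 1)\<close>, so that comparisons of
  weights become equations between natural numbers.\<close>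

lemma weight_generic_mult:
  "weight 2 3 (generic_coeff r) (l, a, b) * generic_coeff r n = of_nat (2 ^ Suc a * 3 ^ Suc b * 25 ^ n) / 25 ^ l"
  by (simp add: weight_def generic_coeff_def)

lemma weight_generic_inj: "inj (weight 2 3 (generic_coeff r))"
proof (rule injI, unfold split_paired_all)
  fix l a b l' a' b'
  assume "weight 2 3 (generic_coeff r) (l, a, b) = weight 2 3 (generic_coeff r) (l', a', b')"
  \<comment> \<open>The factor \<open>generic_coeff r 0\<close> is just the inverse of
    \<open>5 ^ (r - 1)\<close>, so it removes the normalization.\<close>
  then have "weight 2 3 (generic_coeff r) (l, a, b) * generic_coeff r 0 =
      weight 2 3 (generic_coeff r) (l', a', b') * generic_coeff r 0" by (simp only:)
  then have "of_nat (2 ^ Suc a * 3 ^ Suc b * 25 ^ l') = (of_nat (2 ^ Suc a' * 3 ^ Suc b' * 25 ^ l) :: complex)"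
    unfolding weight_generic_mult by (simp add: field_simps)
  then have "2 ^ Suc a * 3 ^ Suc b * 25 ^ l' = (2 ^ Suc a' * 3 ^ Suc b' * 25 ^ l :: nat)"
    unfolding of_nat_eq_iff .
  moreover have "(25 :: nat) ^ n = 5 ^ (2 * n)" for n by (simp add: power_mult)
  ultimately have "2 ^ Suc a * 3 ^ Suc b * 5 ^ (2 * l') = (2 ^ Suc a' * 3 ^ Suc b' * 5 ^ (2 * l) :: nat)" by simp
  from two_three_five_powers_inj[OF this] show "(l, a, b) = (l', a', b')" by simp
qed

text \<open>A parity argument: \<open>2 ^ Suc a\<close> is even and \<open>25 ^ l\<close> is odd.
  The shift of the exponent matters here, since without the factor \<open>t1 * t2\<close> on
  \<open>I\<close> the value would be \<open>1\<close> at \<open>a = b = 0\<close> and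
  \<open>l = n\<close>.\<close>

lemma weight_generic_mult_neq_1: "weight 2 3 (generic_coeff r) (l, a, b) * generic_coeff r n \<noteq> 1"
proof
  assume "weight 2 3 (generic_coeff r) (l, a, b) * generic_coeff r n = 1"
  then have "of_nat (2 ^ Suc a * 3 ^ Suc b * 25 ^ n) = (of_nat (25 ^ l) :: complex)"
    unfolding weight_generic_mult by (simp add: field_simps)
  then have "2 ^ Suc a * 3 ^ Suc b * 25 ^ n = (25 ^ l :: nat)" unfolding of_nat_eq_iff .
  then have "even ((25 :: nat) ^ l)" by (metis dvd_mult2 dvd_triv_left power_Suc)
  then show False by simp
qed

section \<open>Linear algebra for the fixed points: counting eigenvalues and spanning by
  stability\<close>

lemma smult_mat_eq_of_relation:
  fixes X Y Z :: "complex mat"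
  assumes "X \<in> carrier_mat k k" "Y \<in> carrier_mat k k" "Z \<in> carrier_mat k k"
    and rel: "X - c \<cdot>\<^sub>m Y + Z = 0\<^sub>m k k"
  shows "c \<cdot>\<^sub>m Y = X + Z"
proof (rule eq_matI)
  fix i j assume "i < dim_row (X + Z)" "j < dim_col (X + Z)"
  then have ij: "i < k" "j < k" using assms by auto
  have "(X - c \<cdot>\<^sub>m Y + Z) $$ (i, j) = 0" unfolding rel using ij by simp
  then show "(c \<cdot>\<^sub>m Y) $$ (i, j) = (X + Z) $$ (i, j)" using ij assms(1-3) by (simp add: algebra_simps)
qed (use assms in auto)

text \<open>Distinct eigenvalues are distinct roots of the characteristic polynomial, whose degree
  is \<open>k\<close>. Finiteness of \<open>S\<close> is a conclusion, not a hypothesis.\<close>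

lemma card_weights_le:
  fixes g :: "complex mat"
  assumes g: "g \<in> carrier_mat k k" and inj: "inj_on w S"
    and ev: "\<And>s. s \<in> S \<Longrightarrow> u s \<in> carrier_vec k \<and> u s \<noteq> 0\<^sub>v k \<and> g *\<^sub>v u s = w s \<cdot>\<^sub>v u s"
  shows "finite S" "card S \<le> k"
proof -
  let ?R = "{z :: complex. poly (char_poly g) z = 0}"
  have deg: "degree (char_poly g) = k" "char_poly g \<noteq> 0"
    using degree_monic_char_poly[OF g] by auto
  have "w ` S \<subseteq> ?R"
  proof
    fix z assume "z \<in> w ` S"
    then obtain s where "s \<in> S" "z = w s" by blast
    then have "eigenvalue g z"
      using ev[of s] g unfolding eigenvalue_def eigenvector_def by (intro exI[of _ "u s"]) auto
    then show "z \<in> ?R" using eigenvalue_root_char_poly[OF g] by simp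
  qed
  moreover have "finite ?R" using deg(2) by (rule poly_roots_finite)
  ultimately have "finite (w ` S)" "card (w ` S) \<le> card ?R" by (auto intro: finite_subset card_mono)
  then show "finite S" "card S \<le> k"
    using inj card_poly_roots_bound[OF deg(2)] deg(1) by (auto simp: finite_image_iff card_image)
qed

text \<open>The intertwining equations make the range of \<open>P\<close> invariant and let it
  contain the image of \<open>I\<close>. By stability \<open>P\<close> is then surjective, and
  preimages of the unit vectors are the columns of \<open>C\<close>.\<close>

lemma invariant_image_right_inverse:
  assumes st: "stable r k (B1, B2, I, J)" and P: "P \<in> carrier_mat k m"
    and M: "M1 \<in> carrier_mat m m" "M2 \<in> carrier_mat m m" "K \<in> carrier_mat m r"
    and B: "B1 \<in> carrier_mat k k" "B2 \<in> carrier_mat k k"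
    and eq: "P * M1 = B1 * P" "P * M2 = B2 * P" "P * K = I"
  obtains C where "C \<in> carrier_mat m k" "P * C = 1\<^sub>m k"
proof -
  define U where "U = (\<lambda>v. P *\<^sub>v v) ` carrier_vec m"
  have sub: "U \<subseteq> carrier_vec k" using P by (auto simp: U_def)
  have "subspace class_ring U (module_vec TYPE(complex) k)"
  proof (rule subspace_vecI[OF sub])
    show "0\<^sub>v k \<in> U" unfolding U_def using mult_mat_zero_vec[OF P] by (metis image_eqI zero_carrier_vec)
    show "v + w \<in> U" if vw: "v \<in> U" "w \<in> U" for v w
    proof -
      obtain v' w' where "v = P *\<^sub>v v'" "w = P *\<^sub>v w'" "v' \<in> carrier_vec m" "w' \<in> carrier_vec m"
        using vw by (auto simp: U_def)
      then show ?thesis unfolding U_def using mult_add_distrib_mat_vec[OF P, of v' w']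
        by (intro image_eqI[of _ _ "v' + w'"]) auto
    qed
    show "c \<cdot>\<^sub>v v \<in> U" if v: "v \<in> U" for c v
    proof -
      obtain v' where "v = P *\<^sub>v v'" "v' \<in> carrier_vec m"
        using v by (auto simp: U_def)
      then show ?thesis unfolding U_def using mult_mat_vec[OF P, of v' c]
        by (intro image_eqI[of _ _ "c \<cdot>\<^sub>v v'"]) auto
    qed
  qed
  moreover have inv: "\<forall>v\<in>U. B *\<^sub>v v \<in> U"
    if "P * N = B * P" "N \<in> carrier_mat m m" "B \<in> carrier_mat k k" for B N
  proof
    fix v assume "v \<in> U"
    then obtain v' where v': "v = P *\<^sub>v v'" "v' \<in> carrier_vec m" by (auto simp: U_def)
    have "B *\<^sub>v v = P *\<^sub>v (N *\<^sub>v v')"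
      unfolding v'(1) using assoc_mult_mat_vec[OF that(3) P v'(2)] assoc_mult_mat_vec[OF P that(2) v'(2)] that(1)
      by simp
    then show "B *\<^sub>v v \<in> U" unfolding U_def using mult_mat_vec_carrier[OF that(2) v'(2)] by blast
  qed
  moreover have "\<forall>w\<in>carrier_vec r. I *\<^sub>v w \<in> U"
  proof
    fix w :: "complex vec" assume w: "w \<in> carrier_vec r"
    then have "I *\<^sub>v w = P *\<^sub>v (K *\<^sub>v w)" using assoc_mult_mat_vec[OF P M(3) w] eq(3) by simp
    then show "I *\<^sub>v w \<in> U" unfolding U_def using mult_mat_vec_carrier[OF M(3) w] by blast
  qed
  ultimately have "\<not> U \<subset> carrier_vec k"
    using st inv[OF eq(1) M(1) B(1)] inv[OF eq(2) M(2) B(2)] unfolding stable_def by blast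
  then have U: "U = carrier_vec k" using sub by blast
  have "\<exists>c. c \<in> carrier_vec m \<and> P *\<^sub>v c = unit_vec k j" for j
  proof -
    have "unit_vec k j \<in> U" unfolding U by simp
    then show ?thesis by (auto simp: U_def)
  qed
  then obtain c where c: "\<And>j. c j \<in> carrier_vec m" "\<And>j. P *\<^sub>v c j = unit_vec k j" by metis
  define C where "C = mat m k (\<lambda>(i, j). c j $ i)"
  have C: "C \<in> carrier_mat m k" by (simp add: C_def)
  have "P * C = 1\<^sub>m k"
  proof (rule mat_eq_unit_vecI)
    fix j assume j: "j < k"
    have "col C j = c j" using c(1)[of j] j by (intro eq_vecI) (auto simp: C_def)
    then show "(P * C) *\<^sub>v unit_vec k j = 1\<^sub>m k *\<^sub>v unit_vec k j"
      using assoc_mult_mat_vec[OF P C, of "unit_vec k j"] mult_mat_unit_vec[OF C j] c(2)[of j] by simp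
  qed (use P C in auto)
  with C that show ?thesis by blast
qed

section \<open>Structure of the fixed points\<close>

text \<open>Fixedness under one torus element only. The structure results below rest on this alone,
  so this single element already detects the full fixed locus.\<close>

definition generic_fixed :: "nat \<Rightarrow> nat \<Rightarrow> adhm \<Rightarrow> bool" where
  "generic_fixed r k x \<longleftrightarrow>
     (\<exists>g\<in>carrier (GL k). gl_act k g x = torus_act r (2, 3, mat_diag r (generic_coeff r)) x)"

text \<open>Equivariance of \<open>J\<close> gives \<open>z = w * c n * z\<close> for the coordinate
  \<open>z\<close> at index \<open>n\<close> of the image, where \<open>w\<close> is the weight; the
  factor \<open>w * c n\<close> is never \<open>1\<close>.\<close>

lemma generic_fixed_J_monomial_vec:
  assumes x: "(B1, B2, I, J) \<in> adhm_space r k" and fx: "generic_fixed r k (B1, B2, I, J)" and l: "l < r"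
  shows "J *\<^sub>v monomial_vec (B1, B2, I, J) (l, a, b) = 0\<^sub>v r"
proof -
  let ?c = "generic_coeff r" and ?u = "monomial_vec (B1, B2, I, J) (l, a, b)"
  let ?w = "weight 2 3 ?c (l, a, b)"
  obtain g where g: "g \<in> carrier (GL k)"
    and gx: "gl_act k g (B1, B2, I, J) = torus_act r (2, 3, mat_diag r ?c) (B1, B2, I, J)"
    using fx unfolding generic_fixed_def by blast
  note G = GL_D(1)[OF g]
  have J: "J \<in> carrier_mat r k" using x by (simp add: adhm_space_def)
  have u: "?u \<in> carrier_vec k" by (rule monomial_vec_carrier[OF x])
  have D: "mat_diag r ?c \<in> carrier_mat r r" by simp
  have "J = mat_diag r ?c * J * g"
    using gl_act_eq_torus_act_iff[OF g x generic_torus generic_coeff_nonzero] gx by simp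
  then have "J *\<^sub>v ?u = (mat_diag r ?c * J * g) *\<^sub>v ?u" by simp
  also have "\<dots> = (mat_diag r ?c * J) *\<^sub>v (g *\<^sub>v ?u)"
    using assoc_mult_mat_vec[OF mult_carrier_mat[OF D J] G u] .
  also have "\<dots> = ?w \<cdot>\<^sub>v ((mat_diag r ?c * J) *\<^sub>v ?u)"
    unfolding monomial_vec_eigenvector[OF g x generic_torus generic_coeff_nonzero gx l]
    using mult_mat_vec[OF mult_carrier_mat[OF D J] u] .
  also have "\<dots> = ?w \<cdot>\<^sub>v (mat_diag r ?c *\<^sub>v (J *\<^sub>v ?u))"
    using assoc_mult_mat_vec[OF D J u] by simp
  finally have eq: "J *\<^sub>v ?u = ?w \<cdot>\<^sub>v (mat_diag r ?c *\<^sub>v (J *\<^sub>v ?u))" .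
  have diag: "(mat_diag r ?c *\<^sub>v v) $ n = ?c n * v $ n" if "n < r" "v \<in> carrier_vec r" for n v
    using that by (simp add: mat_diag_def scalar_prod_def if_distrib[where f = "\<lambda>z. z * _"] cong: if_cong)
  show ?thesis
  proof (rule eq_vecI)
    fix n assume "n < dim_vec (0\<^sub>v r :: complex vec)"
    then have n: "n < r" by simp
    have "(J *\<^sub>v ?u) $ n = ?w * ((mat_diag r ?c *\<^sub>v (J *\<^sub>v ?u)) $ n)"
      using n by (subst eq) (simp add: mat_diag_def)
    then have "(J *\<^sub>v ?u) $ n = (?w * ?c n) * (J *\<^sub>v ?u) $ n"
      unfolding diag[OF n mult_mat_vec_carrier[OF J u]] by simp
    then show "(J *\<^sub>v ?u) $ n = 0\<^sub>v r $ n"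
      using weight_generic_mult_neq_1[of r l a b n] n by (metis index_zero_vec(1) mult_cancel_right1)
  qed (use J in simp)
qed

text \<open>Since \<open>J\<close> kills the monomial vectors, the defining equation becomes
  \<open>B2 B1 = q\<^sup>2 B1 B2\<close> on them. Carrying \<open>B2\<close> inwards past
  \<open>a\<close> copies of \<open>B1\<close> collects \<open>a\<close> such factors.\<close>

lemma generic_fixed_B2_monomial_vec:
  assumes x: "(B1, B2, I, J) \<in> stable_adhm \<theta> r k" and fx: "generic_fixed r k (B1, B2, I, J)" and l: "l < r"
  shows "B2 *\<^sub>v monomial_vec (B1, B2, I, J) (l, a, b) =
    (q_param \<theta> ^ 2) ^ a \<cdot>\<^sub>v monomial_vec (B1, B2, I, J) (l, a, Suc b)"
proof (induction a)
  case 0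
  show ?case by (simp add: monomial_vec_simps)
next
  case (Suc a)
  let ?Q = "q_param \<theta> ^ 2" and ?u = "monomial_vec (B1, B2, I, J)"
  have Q: "?Q \<noteq> 0" "q_param \<theta> powi (-2) = inverse ?Q" by (simp_all add: q_param_def power_int_minus)
  have B: "B1 \<in> carrier_mat k k" "B2 \<in> carrier_mat k k" "I \<in> carrier_mat k r" "J \<in> carrier_mat r k"
    and rel: "B1 * B2 - (q_param \<theta> powi (-2)) \<cdot>\<^sub>m (B2 * B1) + I * J = 0\<^sub>m k k"
    using x by (auto simp: stable_adhm_def)
  have sp: "(B1, B2, I, J) \<in> adhm_space r k" using x stable_adhm_space by blast
  have u: "?u (l, a, b) \<in> carrier_vec k" for a b by (rule monomial_vec_carrier[OF sp])
  have eq: "inverse ?Q \<cdot>\<^sub>m (B2 * B1) = B1 * B2 + I * J"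
    using smult_mat_eq_of_relation[OF _ _ _ rel] B by (simp add: Q)
  have "inverse ?Q \<cdot>\<^sub>v (B2 *\<^sub>v (B1 *\<^sub>v ?u (l, a, b))) = (inverse ?Q \<cdot>\<^sub>m (B2 * B1)) *\<^sub>v ?u (l, a, b)"
    using smult_mat_mult_vec[OF mult_carrier_mat[OF B(2,1)] u] assoc_mult_mat_vec[OF B(2,1) u] by simp
  also have "\<dots> = (B1 * B2) *\<^sub>v ?u (l, a, b) + (I * J) *\<^sub>v ?u (l, a, b)"
    unfolding eq using B u by (intro add_mult_distrib_mat_vec) auto
  also have "(I * J) *\<^sub>v ?u (l, a, b) = 0\<^sub>v k"
    using assoc_mult_mat_vec[OF B(3,4) u] generic_fixed_J_monomial_vec[OF sp fx l] B by simp
  also have "(B1 * B2) *\<^sub>v ?u (l, a, b) = ?Q ^ a \<cdot>\<^sub>v ?u (l, Suc a, Suc b)"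
    using assoc_mult_mat_vec[OF B(1,2) u] mult_mat_vec[OF B(1) u] by (simp add: Suc monomial_vec_simps)
  also have "?Q ^ a \<cdot>\<^sub>v ?u (l, Suc a, Suc b) + 0\<^sub>v k = ?Q ^ a \<cdot>\<^sub>v ?u (l, Suc a, Suc b)"
    using u by (intro right_zero_vec) simp
  finally have "inverse ?Q \<cdot>\<^sub>v (B2 *\<^sub>v ?u (l, Suc a, b)) = ?Q ^ a \<cdot>\<^sub>v ?u (l, Suc a, Suc b)"
    by (simp only: monomial_vec_simps(2))
  then have "?Q \<cdot>\<^sub>v (inverse ?Q \<cdot>\<^sub>v (B2 *\<^sub>v ?u (l, Suc a, b))) = ?Q \<cdot>\<^sub>v (?Q ^ a \<cdot>\<^sub>v ?u (l, Suc a, Suc b))"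
    by simp
  then show ?case unfolding smult_smult_assoc using Q(1) by simp
qed

text \<open>The size bound holds because the nonzero monomial vectors are eigenvectors of one
  \<open>g\<close> for distinct eigenvalues.\<close>

lemma generic_fixed_box_ideal:
  assumes x: "x \<in> stable_adhm \<theta> r k" and fx: "generic_fixed r k x"
  shows "box_ideal r (support r k x)" "card (support r k x) \<le> k"
proof -
  obtain B1 B2 I J where X: "x = (B1, B2, I, J)" by (cases x)
  have sp: "(B1, B2, I, J) \<in> adhm_space r k" using x stable_adhm_space X by blast
  have B: "B1 \<in> carrier_mat k k" "B2 \<in> carrier_mat k k" using sp by (auto simp: adhm_space_def)
  obtain g where g: "g \<in> carrier (GL k)"
    and gx: "gl_act k g x = torus_act r (2, 3, mat_diag r (generic_coeff r)) x"
    using fx unfolding generic_fixed_def by blast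
  have "s \<in> support r k x \<Longrightarrow> monomial_vec x s \<in> carrier_vec k \<and> monomial_vec x s \<noteq> 0\<^sub>v k \<and>
      g *\<^sub>v monomial_vec x s = weight 2 3 (generic_coeff r) s \<cdot>\<^sub>v monomial_vec x s" for s
    using monomial_vec_eigenvector[OF g _ generic_torus generic_coeff_nonzero gx] monomial_vec_carrier sp X
    unfolding support_def by auto
  from card_weights_le[OF GL_D(1)[OF g] inj_on_subset[OF weight_generic_inj subset_UNIV] this]
  have fin: "finite (support r k x)" and card: "card (support r k x) \<le> k" by blast+
  \<comment> \<open>\<open>B1\<close> is the outermost letter and maps zero to zero.\<close>
  have "(l, a, b) \<in> support r k x" if "(l, Suc a, b) \<in> support r k x" for l a b
    using that B by (auto simp: support_def X monomial_vec_simps(2))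
  \<comment> \<open>\<open>B2\<close> is not outermost, so it is brought in by the commutation rule,
    and the resulting nonzero power of \<open>q\<close> is divided out.\<close>
  moreover have "(l, a, b) \<in> support r k x" if "(l, a, Suc b) \<in> support r k x" for l a b
  proof (rule ccontr)
    assume "(l, a, b) \<notin> support r k x"
    moreover have l: "l < r" using that by (simp add: support_def)
    ultimately have "monomial_vec x (l, a, b) = 0\<^sub>v k" by (simp add: support_def)
    then have z: "(q_param \<theta> ^ 2) ^ a \<cdot>\<^sub>v monomial_vec x (l, a, Suc b) = 0\<^sub>v k"
      using generic_fixed_B2_monomial_vec[OF x[unfolded X] fx[unfolded X] l, of a b] B by (simp add: X)
    let ?v = "monomial_vec x (l, a, Suc b)"
    have "inverse ((q_param \<theta> ^ 2) ^ a) \<cdot>\<^sub>v ((q_param \<theta> ^ 2) ^ a \<cdot>\<^sub>v ?v) = ?v"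
      unfolding smult_smult_assoc by (simp add: q_param_def)
    then have "?v = inverse ((q_param \<theta> ^ 2) ^ a) \<cdot>\<^sub>v 0\<^sub>v k" unfolding z by (rule sym)
    also have "\<dots> = 0\<^sub>v k" by (intro eq_vecI) auto
    finally have "?v = 0\<^sub>v k" .
    then show False using that by (simp add: support_def)
  qed
  moreover have "support r k x \<subseteq> {..<r} \<times> UNIV" by (auto simp: support_def)
  ultimately show "box_ideal r (support r k x)"
    unfolding box_ideal_def using fin by blast
  show "card (support r k x) \<le> k" by (rule card)
qed

text \<open>The matrix \<open>P\<close> with the nonzero monomial vectors as columns intertwines the
  normal form with \<open>x\<close>. Stability gives \<open>k \<le> m\<close> and the eigenvalue
  count gives \<open>m \<le> k\<close>, so \<open>P\<close> is square and invertible. The size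
  \<open>m\<close> is kept separate from \<open>k\<close> because their equality is part of the
  result.\<close>

lemma generic_fixed_model:
  assumes x: "x \<in> stable_adhm \<theta> r k" and fx: "generic_fixed r k x" and Q: "Q = q_param \<theta> ^ 2"
    and e: "bij_betw e {..<m} (support r k x)"
  shows "m = k" "\<exists>g\<in>carrier (GL k). x = gl_act k g (model Q r k e)"
proof -
  obtain B1 B2 I J where X: "x = (B1, B2, I, J)" by (cases x)
  obtain M1 M2 K L where M: "model Q r m e = (M1, M2, K, L)" by (cases "model Q r m e")
  have sp: "(B1, B2, I, J) \<in> adhm_space r k" using x stable_adhm_space X by blast
  have B: "B1 \<in> carrier_mat k k" "B2 \<in> carrier_mat k k" "I \<in> carrier_mat k r" "J \<in> carrier_mat r k"
    and st: "stable r k (B1, B2, I, J)" using x by (auto simp: X stable_adhm_def)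
  have car: "M1 \<in> carrier_mat m m" "M2 \<in> carrier_mat m m" "K \<in> carrier_mat m r" "L \<in> carrier_mat r m"
    using M by (auto simp: model_def)
  have inj: "inj_on e {..<m}" and im: "e ` {..<m} = support r k x" using e by (auto simp: bij_betw_def)
  note mm = model_mult_box_vec[OF M inj, unfolded im]
  define P where "P = mat k m (\<lambda>(i, j). monomial_vec x (e j) $ i)"
  have P: "P \<in> carrier_mat k m" by (simp add: P_def)
  have u: "monomial_vec x (l, a, b) \<in> carrier_vec k" for l a b using monomial_vec_carrier[OF sp] X by simp
  have u': "monomial_vec x s \<in> carrier_vec k" for s by (cases s) (use u in auto)
  have Pe: "P *\<^sub>v unit_vec m j = monomial_vec x (e j)" if "j < m" for j
    unfolding mult_mat_unit_vec[OF P that] using that u'[of "e j"] by (intro eq_vecI) (auto simp: P_def)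
  \<comment> \<open>This also covers boxes outside the support, where both sides are zero; the
    images under \<open>M1\<close> and \<open>M2\<close> may be such boxes.\<close>
  have Pbox: "P *\<^sub>v box_vec e m (l, a, b) = monomial_vec x (l, a, b)" if l: "l < r" for l a b
  proof (cases "(l, a, b) \<in> e ` {..<m}")
    case True
    then obtain j where "j < m" "e j = (l, a, b)" by auto
    then show ?thesis using Pe box_vec_unit_vec[OF inj] by metis
  next
    case False
    then have "monomial_vec x (l, a, b) = 0\<^sub>v k" using l by (auto simp: im support_def)
    then show ?thesis using box_vec_eq_0[OF False] P by simp
  qed
  have ej: "\<exists>l a b. e j = (l, a, b) \<and> l < r \<and> (l, a, b) \<in> support r k x" if "j < m" for j
  proof -
    have "e j \<in> support r k x" using that im by blast
    then show ?thesis by (auto simp: support_def)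
  qed
  have 1: "P * M1 = B1 * P"
  proof (rule mat_eq_unit_vecI)
    fix j assume j: "j < m"
    obtain l a b where s: "e j = (l, a, b)" "l < r" "(l, a, b) \<in> support r k x" using ej[OF j] by blast
    have v: "unit_vec m j = box_vec e m (l, a, b)" using box_vec_unit_vec[OF inj j] s(1) by simp
    have "(P * M1) *\<^sub>v unit_vec m j = monomial_vec x (l, Suc a, b)"
      using assoc_mult_mat_vec[OF P car(1), of "unit_vec m j"] mm(1)[OF s(3)] Pbox[OF s(2)] v by simp
    moreover have "(B1 * P) *\<^sub>v unit_vec m j = B1 *\<^sub>v monomial_vec x (l, a, b)"
      using assoc_mult_mat_vec[OF B(1) P, of "unit_vec m j"] Pe[OF j] s(1) by simp
    ultimately show "(P * M1) *\<^sub>v unit_vec m j = (B1 * P) *\<^sub>v unit_vec m j"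
      by (simp add: X monomial_vec_simps(2))
  qed (use P car B in auto)
  have 2: "P * M2 = B2 * P"
  proof (rule mat_eq_unit_vecI)
    fix j assume j: "j < m"
    obtain l a b where s: "e j = (l, a, b)" "l < r" "(l, a, b) \<in> support r k x" using ej[OF j] by blast
    have v: "unit_vec m j = box_vec e m (l, a, b)" using box_vec_unit_vec[OF inj j] s(1) by simp
    have "(P * M2) *\<^sub>v unit_vec m j = Q ^ a \<cdot>\<^sub>v monomial_vec x (l, a, Suc b)"
      using assoc_mult_mat_vec[OF P car(2), of "unit_vec m j"] mm(2)[OF s(3)] Pbox[OF s(2)] v
        mult_mat_vec[OF P, of "box_vec e m (l, a, Suc b)"] by simp
    moreover have "(B2 * P) *\<^sub>v unit_vec m j = B2 *\<^sub>v monomial_vec x (l, a, b)"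
      using assoc_mult_mat_vec[OF B(2) P, of "unit_vec m j"] Pe[OF j] s(1) by simp
    ultimately show "(P * M2) *\<^sub>v unit_vec m j = (B2 * P) *\<^sub>v unit_vec m j"
      using generic_fixed_B2_monomial_vec[OF x[unfolded X] fx[unfolded X] s(2), of a b] by (simp add: X Q)
  qed (use P car B in auto)
  have 3: "P * K = I"
  proof (rule mat_col_eqI)
    fix l assume "l < dim_col I"
    then have l: "l < r" using B by simp
    have "col (P * K) l = P *\<^sub>v col K l" using P car(3) l by simp
    then show "col (P * K) l = col I l" using mm(3)[OF l] Pbox[OF l] by (simp add: X monomial_vec_simps)
  qed (use P car B in auto)
  obtain C where C: "C \<in> carrier_mat m k" "P * C = 1\<^sub>m k"
    using invariant_image_right_inverse[OF st P car(1-3) B(1,2) 1 2 3] .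
  have "m \<le> k" using bij_betw_same_card[OF e] generic_fixed_box_ideal(2)[OF x fx] by simp
  then show mk: "m = k" using right_inverse_dim_le[OF P C] by simp
  have g: "P \<in> carrier (GL k)" using GL_I P C mk by blast
  \<comment> \<open>The fourth intertwining equation, since the normal form has zero as its last
    matrix.\<close>
  have "J * P = 0\<^sub>m r m"
  proof (rule mat_eq_unit_vecI)
    fix j assume j: "j < m"
    obtain l a b where s: "e j = (l, a, b)" "l < r" using ej[OF j] by blast
    have "(J * P) *\<^sub>v unit_vec m j = J *\<^sub>v monomial_vec x (l, a, b)"
      using assoc_mult_mat_vec[OF B(4) P, of "unit_vec m j"] Pe[OF j] s(1) by simp
    also have "\<dots> = 0\<^sub>v r" using generic_fixed_J_monomial_vec[OF sp _ s(2)] fx X by simp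
    finally show "(J * P) *\<^sub>v unit_vec m j = 0\<^sub>m r m *\<^sub>v unit_vec m j"
      by (auto intro: eq_vecI)
  qed (use P B in auto)
  then have "gl_act k P (M1, M2, K, L) = (B1, B2, I, J)"
    using gl_act_eq_iff[OF g _ sp, of M1 M2 K L] model_space[of Q r m e] M mk 1 2 3 mm(4) by simp
  then show "\<exists>g\<in>carrier (GL k). x = gl_act k g (model Q r k e)" using g X M mk by metis
qed

section \<open>Young diagrams and the fixed locus\<close>

text \<open>A sequence of diagrams becomes one set of labelled boxes, a disjoint union, with
  coordinates shifted to start at \<open>0\<close>.\<close>

definition boxes :: "(nat \<times> nat) set list \<Rightarrow> (nat \<times> nat \<times> nat) set" where
  "boxes Ls = {(l, a, b). l < length Ls \<and> (Suc a, Suc b) \<in> Ls ! l}"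

text \<open>Iterates the one-step closure, lowering \<open>a\<close> at fixed \<open>b\<close> first
  and then \<open>b\<close> at \<open>a'\<close>.\<close>

lemma box_ideal_downward:
  assumes "box_ideal r S" "(l, a, b) \<in> S" "a' \<le> a" "b' \<le> b"
  shows "(l, a', b') \<in> S"
proof -
  have step: "(l, Suc n, b) \<in> S \<Longrightarrow> (l, n, b) \<in> S" "(l, a', Suc n) \<in> S \<Longrightarrow> (l, a', n) \<in> S" for n
    using assms(1) unfolding box_ideal_def by blast+
  have "(l, a', b) \<in> S" using assms(3) by (induction rule: inc_induct) (use assms(2) step(1) in blast)+
  note base = this
  show ?thesis using assms(4) by (induction rule: inc_induct) (use base step(2) in blast)+
qed

lemma card_boxes:
  assumes "\<forall>L\<in>set Ls. young_diagram L"
  shows "finite (boxes Ls)" "card (boxes Ls) = (\<Sum>l<length Ls. card (Ls ! l))"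
proof -
  have Y: "young_diagram (Ls ! l)" if "l < length Ls" for l using assms that by simp
  have "bij_betw (\<lambda>(l, a, b). (l, Suc a, Suc b)) (boxes Ls) (SIGMA l:{..<length Ls}. Ls ! l)"
    unfolding bij_betw_def
  proof
    show "inj_on (\<lambda>(l, a, b). (l, Suc a, Suc b)) (boxes Ls)" by (auto simp: inj_on_def)
    show "(\<lambda>(l, a, b). (l, Suc a, Suc b)) ` boxes Ls = (SIGMA l:{..<length Ls}. Ls ! l)"
    proof (rule antisym)
      show "(SIGMA l:{..<length Ls}. Ls ! l) \<subseteq> (\<lambda>(l, a, b). (l, Suc a, Suc b)) ` boxes Ls"
      proof clarsimp
        fix l p1 p2 assume l: "l < length Ls" "(p1, p2) \<in> Ls ! l"
        \<comment> \<open>Positive coordinates make the truncated subtraction in the preimage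
          exact.\<close>
        then have "1 \<le> p1" "1 \<le> p2" using Y[of l] by (auto simp: young_diagram_def)
        then show "(l, p1, p2) \<in> (\<lambda>(l, a, b). (l, Suc a, Suc b)) ` boxes Ls"
          using l by (intro image_eqI[of _ _ "(l, p1 - 1, p2 - 1)"]) (auto simp: boxes_def)
      qed
    qed (auto simp: boxes_def)
  qed
  moreover have "finite (Ls ! l)" if "l < length Ls" for l using Y[OF that] by (simp add: young_diagram_def)
  ultimately show "finite (boxes Ls)" "card (boxes Ls) = (\<Sum>l<length Ls. card (Ls ! l))"
    by (auto simp: bij_betw_finite bij_betw_same_card)
qed

lemma bij_betw_boxes:
  "bij_betw boxes (young_sequences r k) {S. box_ideal r S \<and> card S = k}"
proof (rule bij_betwI)
  \<comment> \<open>The inverse map. The lower bounds are essential: with truncated subtraction a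
    coordinate \<open>0\<close> would otherwise be read as \<open>1\<close>.\<close>
  define lists where "lists S = map (\<lambda>l. {(p1, p2). 1 \<le> p1 \<and> 1 \<le> p2 \<and> (l, p1 - 1, p2 - 1) \<in> S}) [0..<r]"
    for S :: "(nat \<times> nat \<times> nat) set"
  have len: "length (lists S) = r" for S by (simp add: lists_def)
  have nth: "lists S ! l = {(p1, p2). 1 \<le> p1 \<and> 1 \<le> p2 \<and> (l, p1 - 1, p2 - 1) \<in> S}" if "l < r" for l S
    using that by (simp add: lists_def)
  show "boxes \<in> young_sequences r k \<rightarrow> {S. box_ideal r S \<and> card S = k}"
  proof
    fix Ls assume Ls: "Ls \<in> young_sequences r k"
    then have Y: "\<forall>L\<in>set Ls. young_diagram L" and len: "length Ls = r" by (auto simp: young_sequences_def)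
    have down: "(p1', p2') \<in> Ls ! l"
      if "l < r" "(p1, p2) \<in> Ls ! l" "1 \<le> p1'" "p1' \<le> p1" "1 \<le> p2'" "p2' \<le> p2" for l p1 p2 p1' p2'
    proof -
      have "young_diagram (Ls ! l)" using Y len that(1) by simp
      then show ?thesis using that unfolding young_diagram_def by blast
    qed
    have "box_ideal r (boxes Ls)"
      unfolding box_ideal_def
    proof (intro conjI allI impI)
      fix l a b
      show "(l, Suc a, b) \<in> boxes Ls \<Longrightarrow> (l, a, b) \<in> boxes Ls"
        using down[of l "Suc (Suc a)" "Suc b" "Suc a" "Suc b"] len by (simp add: boxes_def)
      show "(l, a, Suc b) \<in> boxes Ls \<Longrightarrow> (l, a, b) \<in> boxes Ls"
        using down[of l "Suc a" "Suc (Suc b)" "Suc a" "Suc b"] len by (simp add: boxes_def)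
    qed (use card_boxes(1)[OF Y] len in \<open>auto simp: boxes_def\<close>)
    then show "boxes Ls \<in> {S. box_ideal r S \<and> card S = k}"
      using card_boxes(2)[OF Y] Ls len by (simp add: young_sequences_def)
  qed
  have boxes_lists: "boxes (lists S) = S" if "box_ideal r S" for S
    using box_ideal_less[OF that] unfolding boxes_def len by (auto simp: nth)
  show "boxes (lists S) = S" if "S \<in> {S. box_ideal r S \<and> card S = k}" for S
    using boxes_lists that by simp
  show "lists \<in> {S. box_ideal r S \<and> card S = k} \<rightarrow> young_sequences r k"
  proof
    fix S assume "S \<in> {S. box_ideal r S \<and> card S = k}"
    then have S: "box_ideal r S" and card: "card S = k" by auto
    have Y: "young_diagram (lists S ! l)" if l: "l < r" for l
    proof -
      have "lists S ! l \<subseteq> (\<lambda>(l, a, b). (Suc a, Suc b)) ` S"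
        unfolding nth[OF l]
      proof clarify
        fix p1 p2 assume "1 \<le> p1" "1 \<le> p2" "(l, p1 - 1, p2 - 1) \<in> S"
        then show "(p1, p2) \<in> (\<lambda>(l, a, b). (Suc a, Suc b)) ` S"
          by (intro image_eqI[of _ _ "(l, p1 - 1, p2 - 1)"]) auto
      qed
      moreover have "finite S" using S by (rule box_ideal_finite)
      ultimately have "finite (lists S ! l)" by (meson finite_imageI finite_subset)
      moreover have "(p1', p2') \<in> lists S ! l"
        if "(p1, p2) \<in> lists S ! l" "1 \<le> p1'" "p1' \<le> p1" "1 \<le> p2'" "p2' \<le> p2" for p1 p2 p1' p2'
        using that box_ideal_downward[OF S, of l "p1 - 1" "p2 - 1" "p1' - 1" "p2' - 1"] by (auto simp: nth[OF l])
      moreover have "lists S ! l \<subseteq> {1..} \<times> {1..}" by (auto simp: nth[OF l])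
      ultimately show ?thesis unfolding young_diagram_def by blast
    qed
    then have "\<forall>L\<in>set (lists S). young_diagram L" by (auto simp: in_set_conv_nth len)
    then show "lists S \<in> young_sequences r k"
      using card_boxes(2)[of "lists S"] boxes_lists[OF S] card by (simp add: young_sequences_def len)
  qed
  show "lists (boxes Ls) = Ls" if Ls: "Ls \<in> young_sequences r k" for Ls
  proof (rule nth_equalityI)
    have len': "length Ls = r" using Ls by (simp add: young_sequences_def)
    then show "length (lists (boxes Ls)) = length Ls" by (simp add: len)
    fix l assume "l < length (lists (boxes Ls))"
    then have l: "l < r" by (simp add: len)
    then have "Ls ! l \<subseteq> {1..} \<times> {1..}" using Ls len' by (auto simp: young_sequences_def young_diagram_def)
    then show "lists (boxes Ls) ! l = Ls ! l" using l len' by (auto simp: nth boxes_def)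
  qed
qed

text \<open>An ideal with \<open>k\<close> boxes fits into a finite grid: a box with coordinate
  \<open>a\<close> forces the \<open>a + 1\<close> boxes of its row below it, so
  \<open>a < k\<close>, and likewise for \<open>b\<close>.\<close>

lemma finite_box_ideals: "finite {S. box_ideal r S \<and> card S = k}"
proof (rule finite_subset)
  have bound: "a < card S \<and> b < card S" if S: "box_ideal r S" and abs: "(l, a, b) \<in> S" for S l a b
  proof -
    have fin: "finite S" using S by (rule box_ideal_finite)
    have "(\<lambda>i. (l, i, b)) ` {..a} \<subseteq> S" "(\<lambda>i. (l, a, i)) ` {..b} \<subseteq> S"
      using box_ideal_downward[OF S abs] by auto
    then have "card ((\<lambda>i. (l, i, b)) ` {..a}) \<le> card S" "card ((\<lambda>i. (l, a, i)) ` {..b}) \<le> card S"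
      using fin by (auto intro: card_mono)
    then show ?thesis by (simp add: card_image inj_on_def)
  qed
  show "{S. box_ideal r S \<and> card S = k} \<subseteq> Pow ({..<r} \<times> {..<k} \<times> {..<k})"
  proof clarify
    fix S l a b assume S: "box_ideal r S" "(l, a, b) \<in> S"
    then have "l < r" by (rule box_ideal_less)
    then show "l \<in> {..<r} \<and> (a, b) \<in> {..<card S} \<times> {..<card S}" using bound[OF S] by simp
  qed
qed simp

text \<open>Supports recover the ideal from the orbit, which gives injectivity. Surjectivity is the
  normal form of generically fixed data. The function \<open>e\<close> is any fixed choice of an
  enumeration for each finite set of boxes.\<close>

lemma bij_betw_model_orbit:
  assumes e: "\<And>S. finite S \<Longrightarrow> bij_betw (e S) {..<card S} S" and Q: "Q = q_param \<theta> ^ 2"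
  shows "bij_betw (\<lambda>S. orbit (GL k) (gl_act k) (model Q r k (e S)))
    {S. box_ideal r S \<and> card S = k} (fixed_locus \<theta> r k)"
proof -
  let ?orb = "\<lambda>S. orbit (GL k) (gl_act k) (model Q r k (e S))"
  let ?A = "{S. box_ideal r S \<and> card S = k}"
  have eS: "inj_on (e S) {..<k}" "e S ` {..<k} = S" if "S \<in> ?A" for S
    using e[of S] that box_ideal_finite by (auto simp: bij_betw_def)
  have supp: "support r k (model Q r k (e S)) = S" if "S \<in> ?A" for S
    using support_model[of "e S" k r Q] eS[OF that] that by simp
  have "inj_on ?orb ?A"
  proof (rule inj_onI)
    fix S T assume S: "S \<in> ?A" and T: "T \<in> ?A" and "?orb S = ?orb T"
    then have "model Q r k (e T) \<in> ?orb S" using orbit_self[OF model_space] by simp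
    then obtain g where "g \<in> carrier (GL k)" "model Q r k (e T) = gl_act k g (model Q r k (e S))"
      by (auto simp: orbit_def)
    then have "support r k (model Q r k (e T)) = support r k (model Q r k (e S))"
      using support_gl_act[OF _ model_space] by simp
    then show "S = T" using supp S T by simp
  qed
  moreover have "?orb ` ?A = fixed_locus \<theta> r k"
  proof (intro antisym subsetI)
    fix p assume "p \<in> ?orb ` ?A"
    then obtain S where S: "S \<in> ?A" "p = ?orb S" by blast
    have I: "box_ideal r (e S ` {..<k})" using S eS(2) by simp
    have "model Q r k (e S) \<in> stable_adhm \<theta> r k" using model_stable_adhm[OF eS(1)[OF S(1)] I Q] .
    moreover have "torus_act r t ` p = p" if "t \<in> torus r" for t
      unfolding S(2) torus_act_orbit_eq_iff[OF that model_space]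
      by (rule model_fixed[OF eS(1)[OF S(1)] I that])
    ultimately show "p \<in> fixed_locus \<theta> r k"
      unfolding fixed_locus_def instanton_moduli_def orbits_def S(2) by blast
  next
    fix p assume p: "p \<in> fixed_locus \<theta> r k"
    then obtain x where x: "x \<in> stable_adhm \<theta> r k" "p = orbit (GL k) (gl_act k) x"
      unfolding fixed_locus_def instanton_moduli_def orbits_def by blast
    have sp: "x \<in> adhm_space r k" using x(1) stable_adhm_space by blast
    \<comment> \<open>Of all the fixedness conditions only the one for the generic element is
      extracted.\<close>
    have fx: "generic_fixed r k x"
      using p generic_torus[of r] unfolding generic_fixed_def fixed_locus_def x(2)
      by (auto simp: torus_act_orbit_eq_iff[OF generic_torus sp])
    let ?S = "support r k x"
    have I: "box_ideal r ?S" by (rule generic_fixed_box_ideal[OF x(1) fx])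
    then have b: "bij_betw (e ?S) {..<card ?S} ?S" by (intro e box_ideal_finite)
    have card: "card ?S = k" by (rule generic_fixed_model(1)[OF x(1) fx Q b])
    obtain g where g: "g \<in> carrier (GL k)" "x = gl_act k g (model Q r k (e ?S))"
      using generic_fixed_model(2)[OF x(1) fx Q b] by blast
    have "p = ?orb ?S"
      using orbit_gl_act[OF g(1) model_space[of Q r k "e ?S"]] unfolding g(2)[symmetric] x(2) .
    then show "p \<in> ?orb ` ?A" using I card by blast
  qed
  ultimately show ?thesis by (simp add: bij_betw_def)
qed

theorem proposition7p8:
  fixes \<theta> :: complex and r k :: nat
  assumes "r \<ge> 1"
  shows "finite (fixed_locus \<theta> r k) \<and>
         (\<exists>f. bij_betw f (fixed_locus \<theta> r k) (young_sequences r k))"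
proof -
  have "\<exists>e. bij_betw e {..<card S} S" if "finite S" for S :: "(nat \<times> nat \<times> nat) set"
    using ex_bij_betw_nat_finite[OF that] by (simp add: atLeast0LessThan)
  then obtain e where "\<And>S :: (nat \<times> nat \<times> nat) set. finite S \<Longrightarrow> bij_betw (e S) {..<card S} S"
    by metis
  from bij_betw_model_orbit[OF this refl]
  have bij: "bij_betw (\<lambda>S. orbit (GL k) (gl_act k) (model (q_param \<theta> ^ 2) r k (e S)))
    {S. box_ideal r S \<and> card S = k} (fixed_locus \<theta> r k)" .
  have "finite (fixed_locus \<theta> r k)" using bij_betw_finite[OF bij] finite_box_ideals by blast
  moreover have "\<exists>f. bij_betw f (fixed_locus \<theta> r k) (young_sequences r k)"
    \<comment> \<open>Both bijections start from or end at the box ideals, so each is inverted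
      before composing.\<close>
    using bij_betw_trans[OF bij_betw_inv_into[OF bij] bij_betw_inv_into[OF bij_betw_boxes]] by blast
  ultimately show ?thesis by blast
qed

end
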